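(* The problem of deciding whether three given partition matroids on a common ground set have a common basis reduces in polynomial time to the problem of deciding whether the optimum value of a given instance of Common Matroid-constrained Multiway Cut equals $0$.
   Context: A partition matroid on $S$ with classes $U_1,\dots,U_r$ (partition of $S$) has as independent sets the sets meeting each class in at most one element. Common Matroid-constrained Multiway Cut: given a graph $G=(V,E)$, edge weights $w\in\mathbb{R}^E_{\ge 0}$, and two rank-$k$ matroids $\mathcal{M}_1,\mathcal{M}_2$ on $V$ given by independence oracles with basis families $\mathcal{B}_1,\mathcal{B}_2$, find a partition $\{V_1,\dots,V_k\}$ of $V$ for which there exists $B\in\mathcal{B}_1\cap\mathcal{B}_2$ with $|B\cap V_i|=1$ for all $i\in[k]$, minimizing $\sum_{i=1}^k d_w(V_i)$, where $d_w(X)$ is the total weight of edges with exactly one endpoint in $X$. *)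

theory Defs
  imports
    "HOL-Library.Disjoint_Sets"
    "HOL-Library.Extended_Real"
    "HOL-Computational_Algebra.Polynomial"
begin

section \<open>Matroids\<close>

definition matroid :: "'a set \<Rightarrow> 'a set set \<Rightarrow> bool" where
  "matroid V \<I> \<longleftrightarrow> finite V \<and> \<I> \<subseteq> Pow V \<and> {} \<in> \<I> \<and>
     (\<forall>X\<in>\<I>. \<forall>Y. Y \<subseteq> X \<longrightarrow> Y \<in> \<I>) \<and>
     (\<forall>X\<in>\<I>. \<forall>Y\<in>\<I>. card X < card Y \<longrightarrow> (\<exists>y\<in>Y - X. insert y X \<in> \<I>))"

definition bases :: "'a set set \<Rightarrow> 'a set set" where
  "bases \<I> = {B \<in> \<I>. \<forall>X\<in>\<I>. B \<subseteq> X \<longrightarrow> X = B}"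

definition matroid_rank :: "'a set set \<Rightarrow> nat" where
  "matroid_rank \<I> = Max (card ` \<I>)"

definition partition_matroid :: "'a set \<Rightarrow> 'a set set \<Rightarrow> 'a set set" where
  "partition_matroid S \<U> = {X. X \<subseteq> S \<and> (\<forall>U\<in>\<U>. card (X \<inter> U) \<le> 1)}"

section \<open>Common Matroid-constrained Multiway Cut\<close>

definition cut_weight :: "'a set set \<Rightarrow> ('a set \<Rightarrow> real) \<Rightarrow> 'a set \<Rightarrow> real" where
  "cut_weight E w X = (\<Sum>e | e \<in> E \<and> card (e \<inter> X) = 1. w e)"

definition cmmc_instance ::
  "'a set \<Rightarrow> 'a set set \<Rightarrow> ('a set \<Rightarrow> real) \<Rightarrow> 'a set set \<Rightarrow> 'a set set \<Rightarrow> nat \<Rightarrow> bool" where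
  "cmmc_instance V E w \<I>1 \<I>2 k \<longleftrightarrow>
     finite V \<and> (\<forall>e\<in>E. e \<subseteq> V \<and> card e = 2) \<and> (\<forall>e\<in>E. 0 \<le> w e) \<and>
     matroid V \<I>1 \<and> matroid_rank \<I>1 = k \<and> matroid V \<I>2 \<and> matroid_rank \<I>2 = k"

definition cmmc_feasible :: "'a set \<Rightarrow> 'a set set \<Rightarrow> 'a set set \<Rightarrow> nat \<Rightarrow> 'a set set \<Rightarrow> bool" where
  "cmmc_feasible V \<I>1 \<I>2 k \<P> \<longleftrightarrow>
     partition_on V \<P> \<and> card \<P> = k \<and>
     (\<exists>B \<in> bases \<I>1 \<inter> bases \<I>2. \<forall>X\<in>\<P>. card (B \<inter> X) = 1)"

text \<open>The optimum of an infeasible instance is \<open>\<infinity>\<close>.\<close>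

definition cmmc_opt ::
  "'a set \<Rightarrow> 'a set set \<Rightarrow> ('a set \<Rightarrow> real) \<Rightarrow> 'a set set \<Rightarrow> 'a set set \<Rightarrow> nat \<Rightarrow> ereal" where
  "cmmc_opt V E w \<I>1 \<I>2 k =
     (INF \<P> \<in> {\<P>. cmmc_feasible V \<I>1 \<I>2 k \<P>}. ereal (\<Sum>X\<in>\<P>. cut_weight E w X))"

section \<open>Polynomial time\<close>

text \<open>
  Deterministic multi-tape Turing machines with two-way infinite tapes. The symbols
  \<open>Work i\<close> never occur in encodings; they only allow a machine to choose an arbitrary
  finite tape alphabet. A tape is its contents together with the head position.
\<close>

datatype sym = Blank | Zero | One | Comma | Semicolon | Slash | Work nat

datatype move = MLeft | Stay | MRight

record tm =
  tapes :: nat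
  states :: "nat set"
  alphabet :: "sym set"
  start :: nat
  halt :: nat
  delta :: "nat \<Rightarrow> sym list \<Rightarrow> nat \<times> (sym \<times> move) list"

definition wf_tm :: "tm \<Rightarrow> bool" where
  "wf_tm M \<longleftrightarrow>
     tapes M \<ge> 1 \<and> finite (states M) \<and> start M \<in> states M \<and> halt M \<in> states M \<and>
     finite (alphabet M) \<and> {Blank, Zero, One, Comma, Semicolon, Slash} \<subseteq> alphabet M \<and>
     (\<forall>q \<in> states M. \<forall>as. length as = tapes M \<and> set as \<subseteq> alphabet M \<longrightarrow>
        (case delta M q as of (q', acts) \<Rightarrow>
           q' \<in> states M \<and> length acts = tapes M \<and> fst ` set acts \<subseteq> alphabet M))"

type_synonym tape = "(int \<Rightarrow> sym) \<times> int"
type_synonym config = "nat \<times> tape list"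

fun shift :: "move \<Rightarrow> int" where
  "shift MLeft = -1" | "shift Stay = 0" | "shift MRight = 1"

fun act :: "sym \<times> move \<Rightarrow> tape \<Rightarrow> tape" where
  "act (a, m) (t, h) = (t(h := a), h + shift m)"

fun step :: "tm \<Rightarrow> config \<Rightarrow> config" where
  "step M (q, ts) =
     (if q = halt M then (q, ts)
      else case delta M q (map (\<lambda>(t, h). t h) ts) of (q', acts) \<Rightarrow> (q', map2 act acts ts))"

definition word_tape :: "sym list \<Rightarrow> tape" where
  "word_tape u = ((\<lambda>i. if 0 \<le> i \<and> i < int (length u) then u ! nat i else Blank), 0)"

definition init_config :: "tm \<Rightarrow> sym list \<Rightarrow> config" where
  "init_config M u = (start M, word_tape u # replicate (tapes M - 1) (word_tape []))"

text \<open>The output is the maximal blank-free word to the right of, and including, the head cell.\<close>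

definition tape_output :: "tape \<Rightarrow> sym list \<Rightarrow> bool" where
  "tape_output \<tau> v \<longleftrightarrow> (case \<tau> of (t, h) \<Rightarrow>
     Blank \<notin> set v \<and> (\<forall>i < length v. t (h + int i) = v ! i) \<and> t (h + int (length v)) = Blank)"

text \<open>Halting configurations are fixed by \<open>step\<close>, so \<open>n\<close> is an upper bound on the running time.\<close>

definition computes_within :: "tm \<Rightarrow> sym list \<Rightarrow> sym list \<Rightarrow> nat \<Rightarrow> bool" where
  "computes_within M u v n \<longleftrightarrow>
     (case (step M ^^ n) (init_config M u) of (q, ts) \<Rightarrow> q = halt M \<and> tape_output (ts ! 0) v)"

definition polytime_computable ::
  "'a set \<Rightarrow> ('a \<Rightarrow> sym list) \<Rightarrow> ('b \<Rightarrow> sym list) \<Rightarrow> ('a \<Rightarrow> 'b) \<Rightarrow> bool" where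
  "polytime_computable D enc_in enc_out f \<longleftrightarrow>
     (\<exists>M (p :: nat poly). wf_tm M \<and>
        (\<forall>x\<in>D. computes_within M (enc_in x) (enc_out (f x)) (poly p (length (enc_in x)))))"

section \<open>Encodings\<close>

text \<open>
  Ground sets are \<open>{..<n}\<close> and are written in unary; subsets are characteristic vectors
  of length \<open>n\<close>. Edge weights are reduced fractions of binary numbers.
\<close>

definition enc_bool :: "bool \<Rightarrow> sym list" where
  "enc_bool b = [if b then One else Zero]"

definition enc_set :: "nat \<Rightarrow> nat set \<Rightarrow> sym list" where
  "enc_set n X = map (\<lambda>i. if i \<in> X then One else Zero) [0..<n]"

fun enc_nat :: "nat \<Rightarrow> sym list" where
  "enc_nat m = (if m < 2 then [if m = 1 then One else Zero]
                else enc_nat (m div 2) @ [if odd m then One else Zero])"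

definition enc_rat :: "rat \<Rightarrow> sym list" where
  "enc_rat r = (case quotient_of r of (a, b) \<Rightarrow> enc_nat (nat a) @ Slash # enc_nat (nat b))"

text \<open>Three partition matroids: the size of the ground set and the classes of each matroid.\<close>

type_synonym pm_triple = "nat \<times> nat set list \<times> nat set list \<times> nat set list"

fun pm_triple_instance :: "pm_triple \<Rightarrow> bool" where
  "pm_triple_instance (n, Us1, Us2, Us3) \<longleftrightarrow>
     (\<forall>Us \<in> {Us1, Us2, Us3}. distinct Us \<and> partition_on {..<n} (set Us))"

fun has_common_basis :: "pm_triple \<Rightarrow> bool" where
  "has_common_basis (n, Us1, Us2, Us3) \<longleftrightarrow>
     (\<exists>B. \<forall>Us \<in> {Us1, Us2, Us3}. B \<in> bases (partition_matroid {..<n} (set Us)))"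

definition enc_classes :: "nat \<Rightarrow> nat set list \<Rightarrow> sym list" where
  "enc_classes n Us = concat (map (\<lambda>U. Comma # enc_set n U) Us)"

fun enc_pm_triple :: "pm_triple \<Rightarrow> sym list" where
  "enc_pm_triple (n, Us1, Us2, Us3) =
     enc_set n {..<n} @ Semicolon # enc_classes n Us1 @
     Semicolon # enc_classes n Us2 @ Semicolon # enc_classes n Us3"

text \<open>Weighted graphs: the number of vertices and the list of edges with their weights.\<close>

type_synonym wgraph = "nat \<times> (nat set \<times> rat) list"

fun wg_verts :: "wgraph \<Rightarrow> nat set" where
  "wg_verts (n, es) = {..<n}"

fun wg_edges :: "wgraph \<Rightarrow> nat set set" where
  "wg_edges (n, es) = fst ` set es"

fun wg_weight :: "wgraph \<Rightarrow> nat set \<Rightarrow> real" where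
  "wg_weight (n, es) e = (case map_of es e of Some r \<Rightarrow> real_of_rat r | None \<Rightarrow> 0)"

fun wf_wgraph :: "wgraph \<Rightarrow> bool" where
  "wf_wgraph (n, es) \<longleftrightarrow> distinct (map fst es)"

fun enc_wgraph :: "wgraph \<Rightarrow> sym list" where
  "enc_wgraph (n, es) =
     enc_set n {..<n} @ concat (map (\<lambda>(e, r). Semicolon # enc_set n e @ Comma # enc_rat r) es)"

section \<open>Reductions to a problem with oracle input\<close>

text \<open>
  The graph of the target instance is written out in full. Its matroids are given by independence
  oracles, so what a polynomial-time reduction has to supply for them is an algorithm that, from
  the source instance \<open>x\<close> and a vertex set \<open>X\<close> of the target graph, answers the query
  whether \<open>X\<close> is independent, in time polynomial in the length of \<open>x\<close> and \<open>X\<close>.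
\<close>

definition polytime_oracle ::
  "'a set \<Rightarrow> ('a \<Rightarrow> sym list) \<Rightarrow> ('a \<Rightarrow> wgraph) \<Rightarrow> ('a \<Rightarrow> nat set set) \<Rightarrow> bool" where
  "polytime_oracle D enc G \<I> \<longleftrightarrow>
     polytime_computable {(x, X). x \<in> D \<and> X \<subseteq> wg_verts (G x)}
       (\<lambda>(x, X). enc x @ Semicolon # enc_set (card (wg_verts (G x))) X)
       enc_bool (\<lambda>(x, X). X \<in> \<I> x)"

end

theory Submission imports Defs begin

text \<open>
  Let \<open>r\<close> be the common rank of the three matroids. Join each class of the third partition to a
  star of weight-one edges and keep the first two matroids. A partition of cut value \<open>0\<close> has to
  contain every class in one of its parts, so a common basis \<open>B\<close> of the first two matroids that
  meets every part exactly once meets every class at most once; since \<open>card B = r\<close> is also the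
  number of classes, \<open>B\<close> is a basis of the third matroid. Conversely, the classes themselves form a
  feasible partition of value \<open>0\<close>.

  The Turing machines are obtained from a small while language. A control state is the stack of
  commands still to be executed; a program has only finitely many such stacks, so they can be
  numbered.
\<close>

section \<open>A while language for Turing machines\<close>

text \<open>Only the question whether the optimum is 0 matters, so edges of weight one suffice to
  forbid splitting a class: cut weights are nonnegative, and an optimum of 0 is attained because
  there are only finitely many partitions. Two obstacles shape the rest. The target needs two
  matroids of one common rank for every input triple, even when the three partitions differ in their
  number of classes; both oracles therefore count the classes of all three partitions before they
  answer. Furthermore, a tape is a function on the integers, which is awkward for induction, so
  programs run on pairs of lists that show only finitely many cells around the head, and every run
  carries an explicit bound on its number of steps. The centre of a star is the minimum of its class
  because a scan from left to right meets it first.\<close>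

type_synonym zipper = "sym list \<times> sym list"

fun hd_blank :: "sym list \<Rightarrow> sym" where
  "hd_blank [] = Blank" |
  "hd_blank (x # xs) = x"

definition nth_blank :: "sym list \<Rightarrow> nat \<Rightarrow> sym" where
  "nth_blank xs i = (if i < length xs then xs ! i else Blank)"

lemma nth_blank_Cons [simp]:
  "nth_blank (x # xs) 0 = x" "nth_blank (x # xs) (Suc i) = nth_blank xs i"
  "nth_blank [] i = Blank"
  by (auto simp: nth_blank_def)

lemma nth_blank_tl: "nth_blank (tl xs) i = nth_blank xs (Suc i)"
  by (cases xs) auto

lemma hd_blank_eq: "hd_blank xs = nth_blank xs 0"
  by (cases xs) auto

fun zip_act :: "sym \<times> move \<Rightarrow> zipper \<Rightarrow> zipper" where
  "zip_act (a, MRight) (ls, rs) = (a # ls, tl rs)" |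
  "zip_act (a, Stay) (ls, rs) = (ls, a # tl rs)" |
  "zip_act (a, MLeft) (ls, rs) = (tl ls, hd_blank ls # a # tl rs)"

text \<open>The left part of a zipper is stored in reverse; a zipper represents a tape only up to
  trailing blanks on either side.\<close>

definition represents :: "zipper \<Rightarrow> tape \<Rightarrow> bool" where
  "represents z \<tau> \<longleftrightarrow> (\<forall>i. fst \<tau> (snd \<tau> + int i) = nth_blank (snd z) i) \<and>
     (\<forall>i. fst \<tau> (snd \<tau> - 1 - int i) = nth_blank (fst z) i)"

lemma represents_read: "represents z \<tau> \<Longrightarrow> fst \<tau> (snd \<tau>) = hd_blank (snd z)"
  by (auto simp: represents_def hd_blank_eq dest: spec[of _ 0])

lemma represents_act:
  assumes "represents z \<tau>"
  shows "represents (zip_act a z) (act a \<tau>)"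
proof -
  obtain s m where a: "a = (s, m)" by (cases a)
  obtain ls rs where z: "z = (ls, rs)" by (cases z)
  obtain t h where \<tau>: "\<tau> = (t, h)" by (cases \<tau>)
  have R: "t (h + int i) = nth_blank rs i" and L: "t (h - 1 - int i) = nth_blank ls i" for i
    using assms by (auto simp: represents_def z \<tau>)
  have R': "t (h + 1 + int i) = nth_blank rs (Suc i)" for i
    using R[of "Suc i"] by (simp add: algebra_simps)
  have L': "t (h - 2 - int i) = nth_blank ls (Suc i)" for i
    using L[of "Suc i"] by (simp add: algebra_simps)
  have L0: "t (h - 1) = hd_blank ls" using L[of 0] by (simp add: hd_blank_eq)
  show ?thesis
  proof (cases m)
    case MRight
    have "(t(h := s)) (h + 1 - 1 - int i) = nth_blank (s # ls) i" for i
      using L[of "i - 1"] by (cases i) (auto simp: algebra_simps)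
    then show ?thesis using R' by (simp add: a z \<tau> MRight represents_def nth_blank_tl)
  next
    case Stay
    have "(t(h := s)) (h + int i) = nth_blank (s # tl rs) i" for i
      using R[of i] by (cases i) (auto simp: nth_blank_tl)
    then show ?thesis using L by (simp add: a z \<tau> Stay represents_def)
  next
    case MLeft
    have "(t(h := s)) (h - 1 + int i) = nth_blank (hd_blank ls # s # tl rs) i" for i
    proof (cases i)
      case 0 then show ?thesis using L0 by simp
    next
      case (Suc j) then show ?thesis using R[of j] by (cases j) (auto simp: nth_blank_tl algebra_simps)
    qed
    moreover have "(t(h := s)) (h - 1 - 1 - int i) = nth_blank (tl ls) i" for i
      using L'[of i] by (simp add: nth_blank_tl algebra_simps)
    ultimately show ?thesis by (simp add: a z \<tau> MLeft represents_def)
  qed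
qed

text \<open>The freedom in \<open>a\<close> and \<open>b\<close> lets a program start from zippers
  that list the blank cells it will visit. Scans that stop at a blank, or an output that ends at
  one, then find it in the list.\<close>

lemma represents_word_tape: "represents (replicate a Blank, u @ replicate b Blank) (word_tape u)"
  by (auto simp: represents_def word_tape_def nth_blank_def nth_append)

lemma represents_output:
  assumes "represents (ls, v @ Blank # rs) \<tau>" "Blank \<notin> set v"
  shows "tape_output \<tau> v"
proof -
  have "fst \<tau> (snd \<tau> + int i) = nth_blank (v @ Blank # rs) i" for i
    using assms(1) by (auto simp: represents_def)
  then show ?thesis using assms(2)
    by (auto simp: tape_output_def nth_blank_def nth_append split: prod.split)
qed

section \<open>Commands and the finitely many stacks of a program\<close>

type_synonym action = "(nat \<Rightarrow> sym) \<Rightarrow> sym \<times> move"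

text \<open>A conditional is absent on purpose: \<open>Act\<close> is one machine step on several
  tapes at once, and its functions may depend on the symbols under all heads, so case distinctions
  go there.\<close>

datatype com =
    Act "(nat \<times> action) list"
  | Seq com com (infixr ";;" 60)
  | While "(nat \<Rightarrow> sym) \<Rightarrow> bool" com

type_synonym store = "nat \<Rightarrow> zipper"

definition reads :: "store \<Rightarrow> nat \<Rightarrow> sym" where
  "reads \<sigma> = (\<lambda>i. hd_blank (snd (\<sigma> i)))"

lemma reads_apply [simp]: "reads \<sigma> i = hd_blank (snd (\<sigma> i))"
  by (simp add: reads_def)

text \<open>Every update refers to the original \<open>\<sigma> i\<close>, so the listed updates are
  simultaneous. For a repeated index the first entry wins, in agreement with
  \<open>map_of\<close>.\<close>

fun perform :: "(nat \<Rightarrow> sym) \<Rightarrow> (nat \<times> action) list \<Rightarrow> store \<Rightarrow> store" where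
  "perform r [] \<sigma> = \<sigma>" |
  "perform r ((i, g) # us) \<sigma> = (perform r us \<sigma>)(i := zip_act (g r) (\<sigma> i))"

lemma perform_apply:
  "perform r us \<sigma> i = (case map_of us i of None \<Rightarrow> \<sigma> i | Some g \<Rightarrow> zip_act (g r) (\<sigma> i))"
  by (induction us) auto

fun next_stack :: "(nat \<Rightarrow> sym) \<Rightarrow> com list \<Rightarrow> com list" where
  "next_stack r [] = []" |
  "next_stack r (Act us # cs) = cs" |
  "next_stack r ((p ;; q) # cs) = p # q # cs" |
  "next_stack r (While b p # cs) = (if b r then p # While b p # cs else cs)"

fun updates :: "com list \<Rightarrow> (nat \<times> action) list" where
  "updates (Act us # cs) = us" |
  "updates _ = []"

fun com_step :: "com list \<times> store \<Rightarrow> com list \<times> store" where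
  "com_step (cs, \<sigma>) = (next_stack (reads \<sigma>) cs, perform (reads \<sigma>) (updates cs) \<sigma>)"

text \<open>An upper bound for the stacks that occur from \<open>p # cs\<close> on, until
  \<open>cs\<close> itself is exposed. A loop adds nothing infinite: its body runs on top of
  \<open>While b p # cs\<close>, which is already a member.\<close>

fun stacks :: "com \<Rightarrow> com list \<Rightarrow> com list set" where
  "stacks (Act us) cs = {Act us # cs}" |
  "stacks (p ;; q) cs = insert ((p ;; q) # cs) (stacks p (q # cs) \<union> stacks q cs)" |
  "stacks (While b p) cs = insert (While b p # cs) (stacks p (While b p # cs))"

lemma finite_stacks: "finite (stacks p cs)"
  by (induction p arbitrary: cs) auto

lemma Cons_in_stacks [simp, intro]: "p # cs \<in> stacks p cs"
  by (cases p) auto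

text \<open>The only exit is the bare continuation. For a subcommand that exit is a stack of the
  enclosing command: \<open>q # cs\<close> for the first half of a sequence, the loop itself for a
  loop body.\<close>

lemma next_stack_in_stacks: "ds \<in> stacks p cs \<Longrightarrow> next_stack r ds \<in> insert cs (stacks p cs)"
proof (induction p arbitrary: cs)
  case (Seq p q)
  show ?case
  proof (cases "ds = (p ;; q) # cs")
    case False
    then show ?thesis using Seq.IH(1)[of "q # cs"] Seq.IH(2)[of cs] Seq.prems by auto
  qed simp
next
  case (While b p)
  show ?case
  proof (cases "ds = While b p # cs")
    case False
    then show ?thesis using While.IH[of "While b p # cs"] While.prems by auto
  qed simp
qed auto

section \<open>Compilation into a Turing machine\<close>

definition symbols :: "sym set" where
  "symbols = {Blank, Zero, One, Comma, Semicolon, Slash}"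

text \<open>Writing is confined to tapes below \<open>k\<close>. Reads are unrestricted: beyond
  \<open>k\<close> both \<open>pad_reads\<close> and \<open>simulates\<close> fix them to
  \<open>Blank\<close>.\<close>

fun wf_com :: "nat \<Rightarrow> com \<Rightarrow> bool" where
  "wf_com k (Act us) \<longleftrightarrow>
     (\<forall>(i, g) \<in> set us. i < k \<and> (\<forall>r. range r \<subseteq> symbols \<longrightarrow> fst (g r) \<in> symbols))" |
  "wf_com k (p ;; q) \<longleftrightarrow> wf_com k p \<and> wf_com k q" |
  "wf_com k (While b p) \<longleftrightarrow> wf_com k p"

lemma wf_com_updates:
  assumes "ds \<in> stacks p cs" "wf_com k p" "(i, g) \<in> set (updates ds)"
  shows "i < k \<and> (\<forall>r. range r \<subseteq> symbols \<longrightarrow> fst (g r) \<in> symbols)"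
  using assms
proof (induction p arbitrary: cs)
  case (Act us)
  then show ?case by fastforce
next
  case (Seq p q)
  then show ?case by auto
next
  case (While b p)
  then show ?case by auto
qed

definition pad_reads :: "nat \<Rightarrow> sym list \<Rightarrow> nat \<Rightarrow> sym" where
  "pad_reads k as = (\<lambda>i. if i < k then as ! i else Blank)"

definition stack_act :: "(nat \<Rightarrow> sym) \<Rightarrow> com list \<Rightarrow> nat \<Rightarrow> sym \<times> move" where
  "stack_act r cs i = (case map_of (updates cs) i of None \<Rightarrow> (r i, Stay) | Some g \<Rightarrow> g r)"

text \<open>Commands contain functions on symbol readings, so \<open>com list\<close> is not a
  countable type. Hence \<open>code\<close> is a parameter that has to be injective only on the
  stacks of \<open>p\<close>, and the transition function decodes a state by inverting it
  there.\<close>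

definition compile :: "nat \<Rightarrow> com \<Rightarrow> (com list \<Rightarrow> nat) \<Rightarrow> tm" where
  "compile k p code = (let K = insert [] (stacks p []) in
    \<lparr>tapes = k, states = code ` K, alphabet = symbols, start = code [p], halt = code [],
     delta = (\<lambda>q as. let cs = inv_into K code q; r = pad_reads k as in
       (code (next_stack r cs), map (stack_act r cs) [0..<k]))\<rparr>)"

lemma wf_tm_compile:
  assumes wf: "wf_com k p" and k: "k \<ge> 1" and inj: "inj_on code (insert [] (stacks p []))"
  shows "wf_tm (compile k p code)"
proof -
  let ?K = "insert [] (stacks p [])"
  have closed: "next_stack r cs \<in> ?K" if "cs \<in> ?K" for r cs
    using that next_stack_in_stacks by auto
  have sym: "fst (stack_act (pad_reads k as) cs i) \<in> symbols"
    if "cs \<in> ?K" "length as = k" "set as \<subseteq> symbols" for cs as i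
  proof -
    have r: "range (pad_reads k as) \<subseteq> symbols"
    proof
      fix x assume "x \<in> range (pad_reads k as)"
      then obtain i where i: "x = pad_reads k as i" by auto
      show "x \<in> symbols"
      proof (cases "i < k")
        case True
        then have "as ! i \<in> set as" using that by simp
        then show ?thesis using that True i by (auto simp: pad_reads_def)
      next
        case False
        then show ?thesis using i by (simp add: pad_reads_def symbols_def)
      qed
    qed
    show ?thesis
    proof (cases "map_of (updates cs) i")
      case None then show ?thesis using r by (auto simp: stack_act_def)
    next
      case (Some g)
      then have g: "(i, g) \<in> set (updates cs)" by (rule map_of_SomeD)
      then have "cs \<in> stacks p []" using that by auto
      with wf_com_updates[OF _ wf g] r show ?thesis by (simp add: stack_act_def Some)
    qed
  qed
  have delta: "delta (compile k p code) (code cs) as =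
      (code (next_stack (pad_reads k as) cs), map (stack_act (pad_reads k as) cs) [0..<k])"
    if "cs \<in> ?K" for cs as
    using inv_into_f_f[OF inj that] by (simp add: compile_def Let_def)
  have simps: "tapes (compile k p code) = k" "states (compile k p code) = code ` ?K"
    "start (compile k p code) = code [p]" "halt (compile k p code) = code []"
    "alphabet (compile k p code) = symbols"
    by (simp_all only: compile_def Let_def tm.simps)
  have trans: "\<forall>q \<in> code ` ?K. \<forall>as. length as = k \<and> set as \<subseteq> symbols \<longrightarrow>
        (case delta (compile k p code) q as of (q', acts) \<Rightarrow>
           q' \<in> code ` ?K \<and> length acts = k \<and> fst ` set acts \<subseteq> symbols)"
  proof (intro ballI allI impI)
    fix q as assume q: "q \<in> code ` ?K" and as: "length as = k \<and> set as \<subseteq> symbols"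
    from q obtain cs where cs: "cs \<in> ?K" "q = code cs" by blast
    have "code (next_stack (pad_reads k as) cs) \<in> code ` ?K"
      using closed[OF cs(1)] by (rule imageI)
    moreover have "fst ` set (map (stack_act (pad_reads k as) cs) [0..<k]) \<subseteq> symbols"
      using sym[OF cs(1)] as by auto
    ultimately show "case delta (compile k p code) q as of (q', acts) \<Rightarrow>
           q' \<in> code ` ?K \<and> length acts = k \<and> fst ` set acts \<subseteq> symbols"
      unfolding cs(2) delta[OF cs(1)] by simp
  qed
  have p: "[p] \<in> ?K" by auto
  show ?thesis
    unfolding wf_tm_def simps
  proof (intro conjI)
    show "code [p] \<in> code ` ?K" using p by (rule imageI)
    show "finite (code ` ?K)" by (simp add: finite_stacks)
  qed (use k trans in \<open>simp_all add: symbols_def\<close>)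
qed

section \<open>The machine simulates the program\<close>

definition simulates :: "nat \<Rightarrow> (com list \<Rightarrow> nat) \<Rightarrow> com list \<times> store \<Rightarrow> config \<Rightarrow> bool" where
  "simulates k code = (\<lambda>(cs, \<sigma>) (q, ts). q = code cs \<and> length ts = k \<and>
     (\<forall>i<k. represents (\<sigma> i) (ts ! i)) \<and> (\<forall>i\<ge>k. hd_blank (snd (\<sigma> i)) = Blank))"

lemma simulates_step:
  assumes wf: "wf_com k p" and inj: "inj_on code (insert [] (stacks p []))"
    and sim: "simulates k code (cs, \<sigma>) (q, ts)" and cs: "cs \<in> insert [] (stacks p [])"
  shows "simulates k code (com_step (cs, \<sigma>)) (step (compile k p code) (q, ts))"
proof (cases "cs = []")
  case True
  then show ?thesis using sim by (simp add: simulates_def compile_def Let_def)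
next
  case False
  let ?M = "compile k p code"
  from sim have q: "q = code cs" and len: "length ts = k"
    and rep: "\<And>i. i < k \<Longrightarrow> represents (\<sigma> i) (ts ! i)"
    and bl: "\<And>i. i \<ge> k \<Longrightarrow> hd_blank (snd (\<sigma> i)) = Blank"
    by (auto simp: simulates_def)
  have nh: "q \<noteq> halt ?M"
    using False cs inj by (auto simp: q compile_def Let_def inj_on_def)
  have r: "pad_reads k (map (\<lambda>(t, h). t h) ts) = reads \<sigma>"
    using represents_read[OF rep] bl len
    by (auto simp: pad_reads_def fun_eq_iff case_prod_unfold)
  have inv: "inv_into (insert [] (stacks p [])) code q = cs"
    using cs inj by (simp add: q inv_into_f_f)
  let ?acts = "map (stack_act (reads \<sigma>) cs) [0..<k]"
  have step: "step ?M (q, ts) = (code (next_stack (reads \<sigma>) cs), map2 act ?acts ts)"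
    using nh r inv by (simp add: compile_def Let_def)
  have us: "i < k" if "(i, g) \<in> set (updates cs)" for i g
    using wf_com_updates[OF _ wf that] cs that by auto
  have "represents (perform (reads \<sigma>) (updates cs) \<sigma> i) (map2 act ?acts ts ! i)" if i: "i < k" for i
  proof (cases "map_of (updates cs) i")
    case None
    have "act (reads \<sigma> i, Stay) (ts ! i) = ts ! i"
      using represents_read[OF rep[OF i]] by (cases "ts ! i") auto
    then show ?thesis using None i rep len by (simp add: perform_apply stack_act_def)
  next
    case (Some g)
    then show ?thesis using i len represents_act[OF rep[OF i]] by (simp add: perform_apply stack_act_def)
  qed
  moreover have "hd_blank (snd (perform (reads \<sigma>) (updates cs) \<sigma> i)) = Blank" if "i \<ge> k" for i
  proof -
    have "map_of (updates cs) i = None"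
      using us[of i] that by (meson leD map_of_SomeD option.exhaust)
    then show ?thesis using bl that by (simp add: perform_apply)
  qed
  ultimately show ?thesis unfolding step by (simp add: simulates_def len)
qed

section \<open>Timed execution\<close>

text \<open>One step count serves all remaining stacks \<open>cs\<close>; this is what lets runs be
  composed under \<open>;;\<close> and \<open>While\<close>. Since \<open>n\<close> is only an upper
  bound, time bounds can be rounded up freely.\<close>

definition exec :: "com \<Rightarrow> store \<Rightarrow> nat \<Rightarrow> store \<Rightarrow> bool" where
  "exec p \<sigma> n \<sigma>' \<longleftrightarrow> (\<exists>m\<le>n. \<forall>cs. (com_step ^^ m) (p # cs, \<sigma>) = (cs, \<sigma>'))"

lemma exec_mono: "exec p \<sigma> m \<sigma>' \<Longrightarrow> m \<le> n \<Longrightarrow> exec p \<sigma> n \<sigma>'"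
  by (meson exec_def le_trans)

lemma exec_Act: "perform (reads \<sigma>) us \<sigma> = \<sigma>' \<Longrightarrow> exec (Act us) \<sigma> 1 \<sigma>'"
  unfolding exec_def by (rule exI[of _ 1]) simp

text \<open>The additional step is the one that unfolds \<open>p ;; q\<close> on the stack. In
  \<open>exec_While_True\<close> it is the step that evaluates the test.\<close>

lemma exec_Seq:
  assumes "exec p \<sigma> m \<sigma>'" "exec q \<sigma>' n \<sigma>''"
  shows "exec (p ;; q) \<sigma> (m + n + 1) \<sigma>''"
proof -
  obtain a where a: "a \<le> m" "\<And>cs. (com_step ^^ a) (p # cs, \<sigma>) = (cs, \<sigma>')"
    using assms(1) by (auto simp: exec_def)
  obtain b where b: "b \<le> n" "\<And>cs. (com_step ^^ b) (q # cs, \<sigma>') = (cs, \<sigma>'')"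
    using assms(2) by (auto simp: exec_def)
  have "(com_step ^^ Suc (b + a)) ((p ;; q) # cs, \<sigma>) = (cs, \<sigma>'')" for cs
    by (simp add: funpow_Suc_right funpow_add a(2) b(2) del: funpow.simps(2))
  then show ?thesis unfolding exec_def using a(1) b(1)
    by (intro exI[of _ "Suc (b + a)"]) auto
qed

lemma exec_While_False: "\<not> b (reads \<sigma>) \<Longrightarrow> exec (While b p) \<sigma> 1 \<sigma>"
  unfolding exec_def by (rule exI[of _ 1]) simp

lemma exec_While_True:
  assumes "b (reads \<sigma>)" "exec p \<sigma> m \<sigma>'" "exec (While b p) \<sigma>' n \<sigma>''"
  shows "exec (While b p) \<sigma> (m + n + 1) \<sigma>''"
proof -
  obtain c where c: "c \<le> m" "\<And>cs. (com_step ^^ c) (p # cs, \<sigma>) = (cs, \<sigma>')"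
    using assms(2) by (auto simp: exec_def)
  obtain d where d: "d \<le> n" "\<And>cs. (com_step ^^ d) (While b p # cs, \<sigma>') = (cs, \<sigma>'')"
    using assms(3) by (auto simp: exec_def)
  have "(com_step ^^ Suc (d + c)) (While b p # cs, \<sigma>) = (cs, \<sigma>'')" for cs
    by (simp add: funpow_Suc_right funpow_add c(2) d(2) assms(1) del: funpow.simps(2))
  then show ?thesis unfolding exec_def using c(1) d(1)
    by (intro exI[of _ "Suc (d + c)"]) auto
qed

definition initial :: "store \<Rightarrow> sym list \<Rightarrow> bool" where
  "initial \<sigma> u \<longleftrightarrow> represents (\<sigma> 0) (word_tape u) \<and> (\<forall>i>0. represents (\<sigma> i) (word_tape []))"

theorem compile_correct:
  assumes wf: "wf_com k p" and k: "k \<ge> 1"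
  shows "\<exists>M. wf_tm M \<and> (\<forall>u v \<sigma> n \<sigma>' ls rs. initial \<sigma> u \<longrightarrow> exec p \<sigma> n \<sigma>' \<longrightarrow>
    \<sigma>' 0 = (ls, v @ Blank # rs) \<longrightarrow> Blank \<notin> set v \<longrightarrow> computes_within M u v n)"
proof -
  let ?K = "insert [] (stacks p [])"
  have fin: "finite ?K" by (simp add: finite_stacks)
  obtain code :: "com list \<Rightarrow> nat" where inj: "inj_on code ?K"
    using finite_imp_inj_to_nat_seg[OF fin] by (elim exE conjE)
  let ?M = "compile k p code"
  have "computes_within ?M u v n"
    if ini: "initial \<sigma> u" and ex: "exec p \<sigma> n \<sigma>'" and out: "\<sigma>' 0 = (ls, v @ Blank # rs)" "Blank \<notin> set v"
    for u v \<sigma> n \<sigma>' ls rs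
  proof -
    have r0: "represents (\<sigma> 0) (word_tape u)"
      and ri: "\<And>i. i > 0 \<Longrightarrow> represents (\<sigma> i) (word_tape [])"
      using ini by (auto simp: initial_def)
    have "hd_blank (snd (\<sigma> i)) = Blank" if "i > 0" for i
      using represents_read[OF ri[OF that]] by (simp add: word_tape_def)
    moreover have "represents (\<sigma> i) ((word_tape u # replicate (k - 1) (word_tape [])) ! i)" if "i < k" for i
      using r0 ri that by (cases i) auto
    ultimately have init: "simulates k code ([p], \<sigma>) (init_config ?M u)"
      using k by (auto simp: simulates_def init_config_def compile_def Let_def)
    have sim: "simulates k code ((com_step ^^ m) ([p], \<sigma>)) ((step ?M ^^ m) (init_config ?M u))
               \<and> fst ((com_step ^^ m) ([p], \<sigma>)) \<in> ?K" for m
    proof (induction m)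
      case 0
      then show ?case using init by simp
    next
      case (Suc m)
      obtain cs \<tau> where c: "(com_step ^^ m) ([p], \<sigma>) = (cs, \<tau>)" by fastforce
      obtain q ts where t: "(step ?M ^^ m) (init_config ?M u) = (q, ts)" by fastforce
      have cs: "cs \<in> ?K" using Suc c by simp
      have "simulates k code (com_step (cs, \<tau>)) (step ?M (q, ts))"
        using Suc c t simulates_step[OF wf inj _ cs] by (simp del: com_step.simps step.simps)
      moreover have "next_stack (reads \<tau>) cs \<in> ?K"
        using cs next_stack_in_stacks by auto
      ultimately show ?case by (simp add: c t del: step.simps)
    qed
    obtain m where m: "m \<le> n" "(com_step ^^ m) ([p], \<sigma>) = ([], \<sigma>')"
      using ex by (auto simp: exec_def)
    \<comment> \<open>The run may end before the bound \<open>n\<close>; the empty stack is a fixed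
      point, so the run can be padded to exactly \<open>n\<close> steps.\<close>
    have stay: "(com_step ^^ j) ([], \<sigma>') = ([], \<sigma>')" for j
      by (induction j) auto
    have "(com_step ^^ n) ([p], \<sigma>) = ([], \<sigma>')"
      using funpow_add[of "n - m" m com_step] m stay by simp
    then have S: "simulates k code ([], \<sigma>') ((step ?M ^^ n) (init_config ?M u))"
      using sim[of n] by simp
    obtain q ts where t: "(step ?M ^^ n) (init_config ?M u) = (q, ts)" by fastforce
    from S t k out(1) have "q = code []" "represents (ls, v @ Blank # rs) (ts ! 0)"
      by (auto simp: simulates_def dest: spec[of _ 0])
    moreover have "halt ?M = code []" by (simp add: compile_def Let_def)
    ultimately show ?thesis
      using represents_output out(2) by (simp add: computes_within_def t)
  qed
  then show ?thesis using wf_tm_compile[OF wf k inj] by (intro exI[of _ ?M]) auto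
qed

text \<open>In the form \<open>c * (n + 1) ^ d\<close> the bound is positive already for the empty
  word (if \<open>c\<close> is), so additive constants are absorbed and each program below needs a
  single polynomial inequality.\<close>

lemma polytime_computable_exec:
  assumes wf: "wf_com k p" and k: "k \<ge> 1"
    and run: "\<And>x. x \<in> D \<Longrightarrow> \<exists>\<sigma> \<sigma>' ls rs. initial \<sigma> (enc_in x) \<and>
        exec p \<sigma> (c * (length (enc_in x) + 1) ^ d) \<sigma>' \<and> \<sigma>' 0 = (ls, enc_out (f x) @ Blank # rs)"
    and no_blank: "\<And>x. x \<in> D \<Longrightarrow> Blank \<notin> set (enc_out (f x))"
  shows "polytime_computable D enc_in enc_out f"
proof -
  obtain M where M: "wf_tm M" "\<forall>u v \<sigma> n \<sigma>' ls rs. initial \<sigma> u \<longrightarrow> exec p \<sigma> n \<sigma>' \<longrightarrow>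
    \<sigma>' 0 = (ls, v @ Blank # rs) \<longrightarrow> Blank \<notin> set v \<longrightarrow> computes_within M u v n"
    using compile_correct[OF wf k] by (elim exE conjE)
  let ?p = "smult c ([:1, 1:] ^ d)"
  have p: "poly ?p n = c * (n + 1) ^ d" for n :: nat
    by simp
  have "computes_within M (enc_in x) (enc_out (f x)) (poly ?p (length (enc_in x)))" if x: "x \<in> D" for x
  proof -
    obtain \<sigma> \<sigma>' ls rs where *: "initial \<sigma> (enc_in x)"
      "exec p \<sigma> (c * (length (enc_in x) + 1) ^ d) \<sigma>'" "\<sigma>' 0 = (ls, enc_out (f x) @ Blank # rs)"
      using run[OF x] by blast
    show ?thesis unfolding p
      by (rule M(2)[rule_format, OF * no_blank[OF x]])
  qed
  then show ?thesis unfolding polytime_computable_def using M(1) by blast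
qed

section \<open>Moving and scanning on one tape\<close>

definition go :: "nat \<Rightarrow> move \<Rightarrow> com" where
  "go i m = Act [(i, \<lambda>r. (r i, m))]"

lemma exec_go: "exec (go i m) \<sigma> 1 (\<sigma>(i := zip_act (hd_blank (snd (\<sigma> i)), m) (\<sigma> i)))"
  unfolding go_def by (rule exec_Act) simp

lemma exec_scan_right:
  assumes "\<sigma> i = (ls, xs @ rs)" "\<forall>x\<in>set xs. b x" "\<not> b (hd_blank rs)"
  shows "exec (While (\<lambda>r. b (r i)) (go i MRight)) \<sigma> (2 * length xs + 1) (\<sigma>(i := (rev xs @ ls, rs)))"
  using assms
proof (induction xs arbitrary: ls \<sigma>)
  case Nil
  then have "\<sigma>(i := (ls, rs)) = \<sigma>" by auto
  then show ?case using Nil exec_While_False[of "\<lambda>r. b (r i)"] by simp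
next
  case (Cons x xs)
  have "exec (go i MRight) \<sigma> 1 (\<sigma>(i := (x # ls, xs @ rs)))"
    using exec_go[of i MRight \<sigma>] Cons.prems by simp
  moreover have "exec (While (\<lambda>r. b (r i)) (go i MRight)) (\<sigma>(i := (x # ls, xs @ rs)))
      (2 * length xs + 1) (\<sigma>(i := (rev (x # xs) @ ls, rs)))"
    using Cons.IH[of "\<sigma>(i := (x # ls, xs @ rs))" "x # ls"] Cons.prems by (simp del: fun_upd_apply add: fun_upd_same)
  ultimately have "exec (While (\<lambda>r. b (r i)) (go i MRight)) \<sigma>
      (1 + (2 * length xs + 1) + 1) (\<sigma>(i := (rev (x # xs) @ ls, rs)))"
    using Cons.prems by (intro exec_While_True[of "\<lambda>r. b (r i)"]) auto
  then show ?case by (simp del: fun_upd_apply)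
qed

text \<open>The position after a move to the left, kept folded until the left part is known to be a
  \<open>Cons\<close>; if that part is empty, a blank cell comes into view. This form replaces the
  defining equation for \<open>MLeft\<close> in simplification and gives the leftward scans an
  invariant without a case split.\<close>

definition at_left :: "sym list \<Rightarrow> sym list \<Rightarrow> zipper" where
  "at_left ls rs = (tl ls, hd_blank ls # rs)"

lemma at_left_Cons [simp]: "at_left (x # ls) rs = (ls, x # rs)"
  by (simp add: at_left_def)

lemma zip_act_MLeft [simp]: "zip_act (a, MLeft) (ls, rs) = at_left ls (a # tl rs)"
  by (simp add: at_left_def)

declare zip_act.simps(3) [simp del]

lemma exec_scan_left:
  assumes "\<sigma> i = at_left (xs @ c # ls) rs" "\<forall>x\<in>set xs. b x" "\<not> b c"
  shows "exec (While (\<lambda>r. b (r i)) (go i MLeft)) \<sigma> (2 * length xs + 1)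
    (\<sigma>(i := (ls, c # rev xs @ rs)))"
  using assms
proof (induction xs arbitrary: rs \<sigma>)
  case Nil
  then have "\<sigma>(i := (ls, c # rs)) = \<sigma>" by auto
  then show ?case using Nil exec_While_False[of "\<lambda>r. b (r i)"] by simp
next
  case (Cons x xs)
  have "exec (go i MLeft) \<sigma> 1 (\<sigma>(i := at_left (xs @ c # ls) (x # rs)))"
    using exec_go[of i MLeft \<sigma>] Cons.prems by simp
  moreover have "exec (While (\<lambda>r. b (r i)) (go i MLeft)) (\<sigma>(i := at_left (xs @ c # ls) (x # rs)))
      (2 * length xs + 1) (\<sigma>(i := (ls, c # rev (x # xs) @ rs)))"
    using Cons.IH[of "\<sigma>(i := at_left (xs @ c # ls) (x # rs))" "x # rs"] Cons.prems
    by (simp del: fun_upd_apply add: fun_upd_same)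
  ultimately have "exec (While (\<lambda>r. b (r i)) (go i MLeft)) \<sigma>
      (1 + (2 * length xs + 1) + 1) (\<sigma>(i := (ls, c # rev (x # xs) @ rs)))"
    using Cons.prems by (intro exec_While_True[of "\<lambda>r. b (r i)"]) auto
  then show ?case by (simp del: fun_upd_apply)
qed

section \<open>Writing the graph\<close>

text \<open>Tape 0 holds the input and finally the output, which is first assembled on tape 1.\<close>

definition two :: "zipper \<Rightarrow> zipper \<Rightarrow> store" where
  "two z0 z1 = (\<lambda>i. if i = 0 then z0 else if i = 1 then z1 else ([], []))"

lemma two_simps [simp]:
  "two z0 z1 0 = z0" "two z0 z1 (Suc 0) = z1"
  "(two z0 z1)(0 := z) = two z z1" "(two z0 z1)(Suc 0 := z) = two z0 z"
  by (auto simp: two_def)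

lemma exec_scan_right_two:
  assumes "\<forall>x\<in>set xs. b x" "\<not> b (hd_blank rs)"
  shows "exec (While (\<lambda>r. b (r 0)) (go 0 MRight)) (two (ls, xs @ rs) z) (2 * length xs + 1)
    (two (rev xs @ ls, rs) z)"
  using exec_scan_right[of "two (ls, xs @ rs) z" 0 ls xs rs b] assms by simp

lemma exec_go_right_two: "exec (go 0 MRight) (two (ls, x # rs) z) 1 (two (x # ls, rs) z)"
  using exec_go[of 0 MRight "two (ls, x # rs) z"] by simp

text \<open>While the output is assembled, the head of tape 1 stays at its right end, so the zipper
  is \<open>(ms, [])\<close> with \<open>ms\<close> the reversed output so far.\<close>

definition copy_while :: "(sym \<Rightarrow> bool) \<Rightarrow> (sym \<Rightarrow> sym) \<Rightarrow> com" where
  "copy_while b g = While (\<lambda>r. b (r 0)) (Act [(0, \<lambda>r. (r 0, MRight)), (1, \<lambda>r. (g (r 0), MRight))])"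

lemma exec_copy_while:
  assumes "\<forall>x\<in>set xs. b x" "\<not> b (hd_blank rs)"
  shows "exec (copy_while b g) (two (ls, xs @ rs) (ms, [])) (2 * length xs + 1)
    (two (rev xs @ ls, rs) (rev (map g xs) @ ms, []))"
  using assms unfolding copy_while_def
proof (induction xs arbitrary: ls ms)
  case Nil
  then show ?case using exec_While_False[of "\<lambda>r. b (r 0)"] by simp
next
  case (Cons x xs)
  let ?p = "Act [(0, \<lambda>r. (r 0, MRight)), (1, \<lambda>r. (g (r 0), MRight))]"
  have "exec ?p (two (ls, (x # xs) @ rs) (ms, [])) 1 (two (x # ls, xs @ rs) (g x # ms, []))"
    by (rule exec_Act) simp
  moreover have "exec (While (\<lambda>r. b (r 0)) ?p) (two (x # ls, xs @ rs) (g x # ms, []))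
      (2 * length xs + 1) (two (rev (x # xs) @ ls, rs) (rev (map g (x # xs)) @ ms, []))"
    using Cons.IH[of "x # ls" "g x # ms"] Cons.prems by simp
  ultimately have "exec (While (\<lambda>r. b (r 0)) ?p) (two (ls, (x # xs) @ rs) (ms, []))
      (1 + (2 * length xs + 1) + 1) (two (rev (x # xs) @ ls, rs) (rev (map g (x # xs)) @ ms, []))"
    using Cons.prems by (intro exec_While_True[of "\<lambda>r. b (r 0)"]) auto
  then show ?case by simp
qed

definition put :: "sym \<Rightarrow> com" where
  "put s = Act [(1, \<lambda>r. (s, MRight))]"

lemma exec_put: "exec (put s) (two z (ms, [])) 1 (two z (s # ms, []))"
  unfolding put_def by (rule exec_Act) simp

section \<open>The star of one class\<close>

text \<open>Started on the comma in front of a nonempty class, it stops on the second element or,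
  for a singleton, on the symbol behind the class. The test of \<open>class_loop\<close>
  distinguishes these two cases.\<close>

definition find_second :: com where
  "find_second = go 0 MRight ;; While (\<lambda>r. r 0 = Zero) (go 0 MRight) ;;
     go 0 MRight ;; While (\<lambda>r. r 0 = Zero) (go 0 MRight)"

lemma exec_find_second:
  assumes "hd_blank rs \<noteq> Zero"
  shows "exec find_second (two (ls, Comma # replicate a Zero @ One # replicate b Zero @ rs) z)
    (2 * a + 2 * b + 7) (two (rev (Comma # replicate a Zero @ One # replicate b Zero) @ ls, rs) z)"
proof -
  have scan: "exec (While (\<lambda>r. r 0 = Zero) (go 0 MRight)) (two (ls, replicate a Zero @ xs) z)
      (2 * a + 1) (two (replicate a Zero @ ls, xs) z)" if "hd_blank xs \<noteq> Zero" for a ls xs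
    using exec_scan_right_two[of "replicate a Zero" "\<lambda>s. s = Zero" xs ls z] that by simp
  have "exec find_second (two (ls, Comma # replicate a Zero @ One # replicate b Zero @ rs) z)
    (2 * a + 2 * b + 7) (two (replicate b Zero @ One # replicate a Zero @ Comma # ls, rs) z)"
    unfolding find_second_def
    by (rule exec_mono[OF exec_Seq[OF exec_go_right_two exec_Seq[OF scan exec_Seq[OF
          exec_go_right_two scan]]]]) (use assms in simp_all)
  then show ?thesis by simp
qed

text \<open>The move before the scan matters: behind a class the head may already stand on the comma
  of the next one.\<close>

definition go_back :: com where
  "go_back = go 0 MLeft ;; While (\<lambda>r. r 0 \<noteq> Comma) (go 0 MLeft)"

lemma exec_go_back:
  assumes "Comma \<notin> set xs"
  shows "exec go_back (two (rev xs @ Comma # ls, y # rs) z) (2 * length xs + 3)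
    (two (ls, Comma # xs @ y # rs) z)"
proof -
  have 1: "exec (go 0 MLeft) (two (rev xs @ Comma # ls, y # rs) z) 1
     (two (at_left (rev xs @ Comma # ls) (y # rs)) z)"
    using exec_go[of 0 MLeft "two (rev xs @ Comma # ls, y # rs) z"] by simp
  have 2: "exec (While (\<lambda>r. r 0 \<noteq> Comma) (go 0 MLeft)) (two (at_left (rev xs @ Comma # ls) (y # rs)) z)
     (2 * length xs + 1) (two (ls, Comma # xs @ y # rs) z)"
    using exec_scan_left[of "two (at_left (rev xs @ Comma # ls) (y # rs)) z" 0 "rev xs" Comma ls "y # rs"
      "\<lambda>s. s \<noteq> Comma"] assms by auto
  show ?thesis unfolding go_back_def by (rule exec_mono[OF exec_Seq[OF 1 2]]) simp
qed

text \<open>One pass over a class copies its first two elements as an edge and erases the second of them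
  from the class, so repeated passes write the star centred at the minimum.\<close>

definition emit_edge :: com where
  "emit_edge = Act [(0, \<lambda>r. (r 0, MRight)), (1, \<lambda>r. (Semicolon, MRight))] ;;
     copy_while (\<lambda>s. s = Zero) id ;;
     Act [(0, \<lambda>r. (One, MRight)), (1, \<lambda>r. (One, MRight))] ;;
     copy_while (\<lambda>s. s = Zero) id ;;
     Act [(0, \<lambda>r. (Zero, MRight)), (1, \<lambda>r. (One, MRight))] ;;
     copy_while (\<lambda>s. s = Zero \<or> s = One) (\<lambda>s. Zero) ;;
     put Comma ;; put One ;; put Slash ;; put One"

text \<open>The bits \<open>R\<close> behind the second element survive on tape 0 for later edges,
  but become zeros on tape 1, where the characteristic vector of the edge has just two ones. The
  last four symbols are the separator and the weight \<open>1/1\<close>.\<close>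

lemma exec_emit_edge:
  assumes R: "set R \<subseteq> {Zero, One}" and rs: "hd_blank rs \<noteq> Zero" "hd_blank rs \<noteq> One"
  shows "exec emit_edge
    (two (ls, Comma # replicate a Zero @ One # replicate b Zero @ One # R @ rs) (ms, []))
    (2 * a + 2 * b + 2 * length R + 30)
    (two (rev (Comma # replicate a Zero @ One # replicate b Zero @ Zero # R) @ ls, rs)
      (rev (Semicolon # replicate a Zero @ One # replicate b Zero @ One # replicate (length R) Zero
        @ [Comma, One, Slash, One]) @ ms, []))"
proof -
  have A: "exec (Act [(0, \<lambda>r. (r 0, MRight)), (1, \<lambda>r. (s, MRight))]) (two (ls, x # xs) (ms, [])) 1
     (two (x # ls, xs) (s # ms, []))" for s x xs ls ms
    by (rule exec_Act) simp
  have B: "exec (Act [(0, \<lambda>r. (t, MRight)), (1, \<lambda>r. (s, MRight))]) (two (ls, x # xs) (ms, [])) 1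
     (two (t # ls, xs) (s # ms, []))" for s t x xs ls ms
    by (rule exec_Act) simp
  have C: "exec (copy_while (\<lambda>s. s = Zero) id) (two (ls, replicate a Zero @ One # rs) (ms, [])) (2 * a + 1)
    (two (replicate a Zero @ ls, One # rs) (replicate a Zero @ ms, []))" for a ls ms rs
    using exec_copy_while[of "replicate a Zero" "\<lambda>s. s = Zero" "One # rs" id ls ms] by simp
  have D: "exec (copy_while (\<lambda>s. s = Zero \<or> s = One) (\<lambda>s. Zero)) (two (ls, R @ rs) (ms, [])) (2 * length R + 1)
    (two (rev R @ ls, rs) (replicate (length R) Zero @ ms, []))" for ls ms
    using exec_copy_while[of R "\<lambda>s. s = Zero \<or> s = One" rs "\<lambda>s. Zero" ls ms] R rs
    by (auto simp: map_replicate_const)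
  have eq: "rev (Comma # replicate a Zero @ One # replicate b Zero @ Zero # R) @ ls
     = rev R @ Zero # replicate b Zero @ One # replicate a Zero @ Comma # ls"
    "rev (Semicolon # replicate a Zero @ One # replicate b Zero @ One # replicate (length R) Zero
        @ [Comma, One, Slash, One]) @ ms = One # Slash # One # Comma # replicate (length R) Zero
        @ One # replicate b Zero @ One # replicate a Zero @ Semicolon # ms"
    by simp_all
  show ?thesis unfolding emit_edge_def eq
    by (rule exec_mono[OF exec_Seq[OF A exec_Seq[OF C exec_Seq[OF B exec_Seq[OF C exec_Seq[OF B
       exec_Seq[OF D exec_Seq[OF exec_put exec_Seq[OF exec_put exec_Seq[OF exec_put exec_put]]]]]]]]]]) simp
qed

text \<open>A segment of a characteristic vector, so that \<open>enc_set n U\<close> can be cut at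
  the positions where the head stops.\<close>

definition bits :: "nat set \<Rightarrow> nat \<Rightarrow> nat \<Rightarrow> sym list" where
  "bits U a b = map (\<lambda>i. if i \<in> U then One else Zero) [a..<b]"

lemma enc_set_bits: "enc_set n U = bits U 0 n"
  by (simp add: enc_set_def bits_def)

lemma length_bits [simp]: "length (bits U a b) = b - a"
  by (simp add: bits_def)

lemma set_bits: "set (bits U a b) \<subseteq> {Zero, One}"
  by (auto simp: bits_def)

lemma bits_append: "a \<le> b \<Longrightarrow> b \<le> c \<Longrightarrow> bits U a c = bits U a b @ bits U b c"
  using upt_add_eq_append[of a b "c - b"] by (simp add: bits_def)

lemma bits_Cons: "a < b \<Longrightarrow> bits U a b = (if a \<in> U then One else Zero) # bits U (Suc a) b"
  by (simp add: bits_def upt_conv_Cons)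

lemma bits_zero: "U \<inter> {a..<b} = {} \<Longrightarrow> bits U a b = replicate (b - a) Zero"
  by (auto simp: bits_def list_eq_iff_nth_eq)

lemma bits_cong: "U \<inter> {a..<b} = W \<inter> {a..<b} \<Longrightarrow> bits U a b = bits W a b"
  by (auto simp: bits_def)

definition class_loop :: com where
  "class_loop = While (\<lambda>r. r 0 = One) (go_back ;; emit_edge ;; go_back ;; find_second)"

definition enc_edge :: "nat \<Rightarrow> nat set \<times> rat \<Rightarrow> sym list" where
  "enc_edge n = (\<lambda>(e, r). Semicolon # enc_set n e @ Comma # enc_rat r)"

lemma enc_rat_1: "enc_rat 1 = [One, Slash, One]"
  by (simp add: enc_rat_def)

lemma enc_edge_pair:
  assumes "i < j" "j < n"
  shows "enc_edge n ({i, j}, 1) = Semicolon # replicate i Zero @ One # replicate (j - Suc i) Zero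
    @ One # replicate (n - Suc j) Zero @ [Comma, One, Slash, One]"
proof -
  have "bits {i, j} 0 n = bits {i, j} 0 i @ bits {i, j} i n" using assms by (intro bits_append) auto
  also have "bits {i, j} i n = One # bits {i, j} (Suc i) n" using assms by (subst bits_Cons) auto
  also have "bits {i, j} (Suc i) n = bits {i, j} (Suc i) j @ bits {i, j} j n"
    using assms by (intro bits_append) auto
  also have "bits {i, j} j n = One # bits {i, j} (Suc j) n" using assms by (subst bits_Cons) auto
  finally show ?thesis using assms by (simp add: enc_edge_def enc_set_bits enc_rat_1 bits_zero)
qed

text \<open>The default \<open>n\<close> is the position just behind the class, so one expression
  covers both places where \<open>find_second\<close> can stop.\<close>

definition first_of :: "nat list \<Rightarrow> nat \<Rightarrow> nat" where
  "first_of js n = (case js of [] \<Rightarrow> n | j # _ \<Rightarrow> j)"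

lemma bits_first_of:
  assumes "sorted_wrt (<) (i # js)" "set (i # js) \<subseteq> {..<n}"
  shows "bits (set (i # js)) 0 (first_of js n) =
      replicate i Zero @ One # replicate (first_of js n - Suc i) Zero"
    "bits (set (i # js)) 0 n = bits (set (i # js)) 0 (first_of js n) @ bits (set (i # js)) (first_of js n) n"
    "Suc i \<le> first_of js n" "first_of js n \<le> n"
proof -
  let ?U = "set (i # js)" and ?m = "first_of js n"
  show m: "Suc i \<le> ?m" "?m \<le> n" using assms by (auto simp: first_of_def split: list.split)
  have no: "?U \<inter> {0..<i} = {}" "?U \<inter> {Suc i..<?m} = {}"
    using assms by (fastforce simp: first_of_def split: list.splits)+
  have "bits ?U 0 ?m = bits ?U 0 i @ bits ?U i ?m" using m by (intro bits_append) auto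
  also have "bits ?U i ?m = One # bits ?U (Suc i) ?m" using m by (subst bits_Cons) auto
  finally show "bits ?U 0 ?m = replicate i Zero @ One # replicate (?m - Suc i) Zero"
    using bits_zero[OF no(1)] bits_zero[OF no(2)] by simp
  show "bits ?U 0 n = bits ?U 0 ?m @ bits ?U ?m n" using m by (intro bits_append) auto
qed

lemma exec_find_second_bits:
  assumes s: "sorted_wrt (<) (i # js)" "set (i # js) \<subseteq> {..<n}"
    and rs: "hd_blank rs \<noteq> Zero"
  shows "exec find_second (two (ls, Comma # bits (set (i # js)) 0 n @ rs) z) (2 * n + 7)
    (two (rev (Comma # bits (set (i # js)) 0 (first_of js n)) @ ls,
          bits (set (i # js)) (first_of js n) n @ rs) z)"
proof -
  let ?U = "set (i # js)" and ?m = "first_of js n"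
  note b = bits_first_of[OF s]
  have h: "hd_blank (bits ?U ?m n @ rs) \<noteq> Zero"
  proof (cases js)
    case Nil
    then show ?thesis using rs by (simp add: first_of_def bits_def)
  next
    case (Cons j js')
    then have "j < n" using s by auto
    then show ?thesis using Cons by (simp add: first_of_def bits_Cons)
  qed
  have "exec find_second (two (ls, Comma # bits ?U 0 n @ rs) z) (2 * i + 2 * (?m - Suc i) + 7)
    (two (rev (Comma # bits ?U 0 ?m) @ ls, bits ?U ?m n @ rs) z)"
    using exec_find_second[OF h, of ls i "?m - Suc i" z] unfolding b(2) b(1) by simp
  then show ?thesis by (rule exec_mono) (use b(3,4) in simp)
qed

lemma Comma_notin_bits [simp]: "Comma \<notin> set (bits U a b)"
  using set_bits[of U a b] by auto

text \<open>Induction on the elements other than the centre \<open>i\<close>. One round writes the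
  edge to the next element \<open>j\<close> and clears its bit; what remains on tape 0 is precisely
  the encoding of the class without \<open>j\<close>, to which the induction hypothesis applies. In
  the end only the bit of \<open>i\<close> is left.\<close>

lemma exec_class_loop:
  assumes "sorted_wrt (<) (i # js)" "set (i # js) \<subseteq> {..<n}" "y = Comma \<or> y = Blank"
  shows "exec class_loop
    (two (rev (Comma # bits (set (i # js)) 0 (first_of js n)) @ ls,
          bits (set (i # js)) (first_of js n) n @ y # rs) (ms, []))
    (length js * (8 * n + 50) + 1)
    (two (rev (Comma # bits {i} 0 n) @ ls, y # rs)
      (rev (concat (map (\<lambda>j. enc_edge n ({i, j}, 1)) js)) @ ms, []))"
  using assms
proof (induction js arbitrary: ms)
  case Nil
  have "\<not> reads (two (rev (Comma # bits {i} 0 n) @ ls, y # rs) (ms, [])) 0 = One"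
    using Nil by auto
  then show ?case unfolding class_loop_def using Nil exec_While_False[of "\<lambda>r. r 0 = One"]
    by (simp add: first_of_def bits_def[of _ n n])
next
  case (Cons j js)
  let ?U = "set (i # j # js)" and ?W = "set (i # js)" and ?m = "first_of js n"
  let ?R = "bits ?U (Suc j) n"
  have s': "sorted_wrt (<) (i # js)" "set (i # js) \<subseteq> {..<n}" and ij: "i < j" "j < n"
    using Cons.prems by auto
  have f: "first_of (j # js) n = j" by (simp add: first_of_def)
  note b = bits_first_of[OF Cons.prems(1,2), unfolded f]
  have Uj: "bits ?U j n = One # ?R" using ij by (simp add: bits_Cons)
  have W: "bits ?W 0 n = replicate i Zero @ One # replicate (j - Suc i) Zero @ Zero # ?R"
  proof -
    have "bits ?W 0 n = bits ?W 0 j @ bits ?W j n" using ij by (intro bits_append) auto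
    also have "bits ?W 0 j = bits ?U 0 j" by (rule bits_cong) auto
    also have "bits ?W j n = Zero # bits ?W (Suc j) n"
      using ij Cons.prems(1) by (subst bits_Cons) auto
    also have "bits ?W (Suc j) n = ?R" using ij by (intro bits_cong) auto
    finally show ?thesis using b(1) by simp
  qed
  have y: "hd_blank (y # rs) \<noteq> Zero" "hd_blank (y # rs) \<noteq> One" using Cons.prems by auto
  let ?e = "enc_edge n ({i, j}, 1)"
  have 1: "exec go_back (two (rev (bits ?U 0 j) @ Comma # ls, One # ?R @ y # rs) (ms, [])) (2 * n + 3)
     (two (ls, Comma # bits ?U 0 j @ One # ?R @ y # rs) (ms, []))"
    by (rule exec_mono[OF exec_go_back]) (use ij in auto)
  have 2: "exec emit_edge (two (ls, Comma # bits ?U 0 j @ One # ?R @ y # rs) (ms, [])) (2 * n + 30)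
     (two (rev (bits ?W 0 n) @ Comma # ls, y # rs) (rev ?e @ ms, []))"
  proof -
    have "exec emit_edge (two (ls, Comma # bits ?U 0 j @ One # ?R @ y # rs) (ms, []))
        (2 * i + 2 * (j - Suc i) + 2 * length ?R + 30)
        (two (rev (bits ?W 0 n) @ Comma # ls, y # rs) (rev ?e @ ms, []))"
      using exec_emit_edge[OF set_bits y, of ls i "j - Suc i" ?U "Suc j" n ms]
      unfolding b(1) W enc_edge_pair[OF ij] by simp
    then show ?thesis by (rule exec_mono) (use ij in simp)
  qed
  have 3: "exec go_back (two (rev (bits ?W 0 n) @ Comma # ls, y # rs) (rev ?e @ ms, [])) (2 * n + 3)
     (two (ls, Comma # bits ?W 0 n @ y # rs) (rev ?e @ ms, []))"
    by (rule exec_mono[OF exec_go_back]) auto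
  note 4 = exec_find_second_bits[OF s' y(1), of ls "(rev ?e @ ms, [])"]
  note 5 = Cons.IH[OF s' Cons.prems(3), of "rev ?e @ ms", unfolded class_loop_def]
  \<comment> \<open>The four parts and three sequencing steps add up to \<open>8 * n + 46\<close>;
    with the loop test this stays below the \<open>8 * n + 50\<close> charged per round.\<close>
  note body = exec_Seq[OF 1 exec_Seq[OF 2 exec_Seq[OF 3 4]]]
  have "exec class_loop (two (rev (bits ?U 0 j) @ Comma # ls, One # ?R @ y # rs) (ms, []))
     (length (j # js) * (8 * n + 50) + 1)
     (two (rev (Comma # bits {i} 0 n) @ ls, y # rs)
      (rev (concat (map (\<lambda>j. enc_edge n ({i, j}, 1)) (j # js))) @ ms, []))"
    unfolding class_loop_def
    by (rule exec_mono) (use exec_While_True[OF _ body 5] in auto)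
  then show ?case unfolding f Uj by simp
qed

text \<open>A list rather than a set, in the order in which the machine writes the edges, because
  the encoding of the graph depends on that order. A singleton class has no edges. The weight 1 has
  no meaning beyond being positive.\<close>

definition star :: "nat set \<Rightarrow> (nat set \<times> rat) list" where
  "star U = map (\<lambda>j. ({Min U, j}, 1)) (sorted_list_of_set (U - {Min U}))"

lemma exec_class:
  assumes U: "U \<noteq> {}" "U \<subseteq> {..<n}" and y: "y = Comma \<or> y = Blank"
  shows "exec (find_second ;; class_loop) (two (ls, Comma # enc_set n U @ y # rs) (ms, []))
    ((n + 1) * (8 * n + 50))
    (two (rev (Comma # enc_set n {Min U}) @ ls, y # rs)
      (rev (concat (map (enc_edge n) (star U))) @ ms, []))"
proof -
  have fin: "finite U" using U(2) finite_subset by blast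
  define js where "js = sorted_list_of_set (U - {Min U})"
  have js: "set js = U - {Min U}" "length js = card (U - {Min U})"
    using fin by (auto simp: js_def)
  have Min: "Min U \<in> U" "\<And>j. j \<in> U - {Min U} \<Longrightarrow> Min U < j"
    using fin U(1) by (auto simp: less_le)
  have s: "sorted_wrt (<) (Min U # js)"
    using Min js(1) by (simp add: js_def strict_sorted_list_of_set)
  have UU: "set (Min U # js) = U" using js(1) Min by auto
  have s2: "set (Min U # js) \<subseteq> {..<n}" using UU U by simp
  have len: "length js \<le> n" using js(2) card_mono[of "{..<n}" "U - {Min U}"] U(2) by auto
  have y': "hd_blank (y # rs) \<noteq> Zero" using y by auto
  have st: "map (enc_edge n) (star U) = map (\<lambda>j. enc_edge n ({Min U, j}, 1)) js"
    by (simp add: star_def js_def)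
  note e = exec_Seq[OF exec_find_second_bits[OF s s2 y'] exec_class_loop[OF s s2 y], unfolded UU]
  have "length js * (8 * n + 50) \<le> n * (8 * n + 50)" using len by (rule mult_le_mono1)
  then show ?thesis unfolding st enc_set_bits
    by (intro exec_mono[OF e]) (simp add: algebra_simps)
qed

section \<open>All classes, and delivery of the output\<close>

definition classes_com :: com where
  "classes_com = While (\<lambda>r. r 0 = Comma) (find_second ;; class_loop)"

lemma enc_classes_Nil [simp]: "enc_classes n [] = []"
  and enc_classes_Cons [simp]: "enc_classes n (U # Us) = Comma # enc_set n U @ enc_classes n Us"
  by (simp_all add: enc_classes_def)

lemma exec_classes:
  assumes "\<forall>U\<in>set Us. U \<noteq> {} \<and> U \<subseteq> {..<n}"
  shows "\<exists>ls'. exec classes_com (two (ls, enc_classes n Us @ Blank # rs) (ms, []))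
    (length Us * ((n + 1) * (8 * n + 50) + 1) + 1)
    (two (ls', Blank # rs) (rev (concat (map (enc_edge n) (concat (map star Us)))) @ ms, []))"
  using assms
proof (induction Us arbitrary: ls ms)
  case Nil
  have "exec classes_com (two (ls, Blank # rs) (ms, [])) 1 (two (ls, Blank # rs) (ms, []))"
    unfolding classes_com_def by (rule exec_While_False) simp
  then show ?case by (auto simp del: split_paired_Ex)
next
  case (Cons U Us)
  \<comment> \<open>The symbol behind a class is the comma of the next class or the blank behind the
    input, which are the two cases that \<open>exec_class\<close> admits.\<close>
  obtain y ys where y: "enc_classes n Us @ Blank # rs = y # ys" "y = Comma \<or> y = Blank"
    by (cases Us) auto
  let ?ls = "rev (Comma # enc_set n {Min U}) @ ls"
  let ?ms = "rev (concat (map (enc_edge n) (star U))) @ ms"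
  have 1: "exec (find_second ;; class_loop)
      (two (ls, Comma # enc_set n U @ enc_classes n Us @ Blank # rs) (ms, []))
      ((n + 1) * (8 * n + 50)) (two (?ls, enc_classes n Us @ Blank # rs) (?ms, []))"
    unfolding y(1) using Cons.prems y(2) by (intro exec_class) auto
  obtain ls' where 2: "exec classes_com (two (?ls, enc_classes n Us @ Blank # rs) (?ms, []))
      (length Us * ((n + 1) * (8 * n + 50) + 1) + 1)
      (two (ls', Blank # rs) (rev (concat (map (enc_edge n) (concat (map star Us)))) @ ?ms, []))"
    using Cons.IH Cons.prems by fastforce
  have "exec classes_com (two (ls, Comma # enc_set n U @ enc_classes n Us @ Blank # rs) (ms, []))
      (length (U # Us) * ((n + 1) * (8 * n + 50) + 1) + 1)
      (two (ls', Blank # rs) (rev (concat (map (enc_edge n) (concat (map star Us)))) @ ?ms, []))"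
    unfolding classes_com_def
    by (rule exec_mono[OF exec_While_True[OF _ 1 2[unfolded classes_com_def]]]) simp_all
  then show ?case by (auto simp del: split_paired_Ex)
qed

text \<open>Copying backwards leaves the head of tape 0 on the first symbol of the output. It starts
  on the first blank behind the input, so the next blank terminates the output; whatever is left of
  the input lies to the left, outside the view of \<open>tape_output\<close>.\<close>

definition move_output :: com where
  "move_output = go 1 MLeft ;;
     While (\<lambda>r. r 1 \<noteq> Blank) (Act [(0, \<lambda>r. (r 1, MLeft)), (1, \<lambda>r. (r 1, MLeft))]) ;;
     go 0 MRight"

lemma exec_move_loop:
  assumes "Blank \<notin> set xs"
  shows "\<exists>ls' x' z'. exec
    (While (\<lambda>r. r 1 \<noteq> Blank) (Act [(0, \<lambda>r. (r 1, MLeft)), (1, \<lambda>r. (r 1, MLeft))]))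
    (two (ls, x # rs) (at_left xs zs)) (2 * length xs + 1) (two (ls', x' # rev xs @ rs) z')"
  using assms
proof (induction xs arbitrary: ls x rs zs)
  case Nil
  let ?s = "two (ls, x # rs) (at_left [] zs)"
  have "exec (While (\<lambda>r. r 1 \<noteq> Blank) (Act [(0, \<lambda>r. (r 1, MLeft)), (1, \<lambda>r. (r 1, MLeft))])) ?s 1 ?s"
    by (rule exec_While_False) (simp add: at_left_def)
  then show ?case by (auto simp del: split_paired_Ex)
next
  case (Cons y xs)
  let ?p = "Act [(0, \<lambda>r. (r 1, MLeft)), (1, \<lambda>r. (r 1, MLeft))]"
  have 1: "exec ?p (two (ls, x # rs) (at_left (y # xs) zs)) 1
      (two (tl ls, hd_blank ls # y # rs) (at_left xs (y # zs)))"
    by (rule exec_Act) (simp add: at_left_def[of ls])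
  obtain ls' x' z' where 2: "exec (While (\<lambda>r. r 1 \<noteq> Blank) ?p)
      (two (tl ls, hd_blank ls # y # rs) (at_left xs (y # zs))) (2 * length xs + 1)
      (two (ls', x' # rev xs @ y # rs) z')"
    using Cons.IH[of "tl ls" "hd_blank ls" "y # rs" "y # zs"] Cons.prems by auto
  have "exec (While (\<lambda>r. r 1 \<noteq> Blank) ?p) (two (ls, x # rs) (at_left (y # xs) zs))
      (2 * length (y # xs) + 1) (two (ls', x' # rev xs @ y # rs) z')"
    by (rule exec_mono[OF exec_While_True[OF _ 1 2]]) (use Cons.prems in auto)
  then show ?case by (auto simp del: split_paired_Ex)
qed

lemma exec_move_output:
  assumes "Blank \<notin> set v"
  shows "\<exists>ls' z'. exec move_output (two (ls, x # rs) (rev v, [])) (2 * length v + 5)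
    (two (ls', v @ rs) z')"
proof -
  have 1: "exec (go 1 MLeft) (two (ls, x # rs) (rev v, [])) 1 (two (ls, x # rs) (at_left (rev v) [Blank]))"
    using exec_go[of 1 MLeft "two (ls, x # rs) (rev v, [])"] by simp
  obtain ls' x' z' where 2: "exec
    (While (\<lambda>r. r 1 \<noteq> Blank) (Act [(0, \<lambda>r. (r 1, MLeft)), (1, \<lambda>r. (r 1, MLeft))]))
    (two (ls, x # rs) (at_left (rev v) [Blank])) (2 * length (rev v) + 1)
    (two (ls', x' # rev (rev v) @ rs) z')"
    using exec_move_loop[of "rev v" ls x rs "[Blank]"] assms by auto
  have "exec move_output (two (ls, x # rs) (rev v, [])) (2 * length v + 5)
    (two (x' # ls', rev (rev v) @ rs) z')"
    unfolding move_output_def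
    by (rule exec_mono[OF exec_Seq[OF 1 exec_Seq[OF 2 exec_go_right_two]]]) simp
  then show ?thesis by (auto simp del: split_paired_Ex)
qed

text \<open>The first move leaves the semicolon that opens the section, so that the scan stops at
  the following one.\<close>

definition skip_section :: com where
  "skip_section = go 0 MRight ;; While (\<lambda>r. r 0 \<noteq> Semicolon) (go 0 MRight)"

lemma exec_skip_section:
  assumes "Semicolon \<notin> set xs"
  shows "exec skip_section (two (ls, y # xs @ Semicolon # rs) z) (2 * length xs + 3)
    (two (rev xs @ y # ls, Semicolon # rs) z)"
proof -
  have 2: "exec (While (\<lambda>r. r 0 \<noteq> Semicolon) (go 0 MRight)) (two (y # ls, xs @ Semicolon # rs) z)
     (2 * length xs + 1) (two (rev xs @ y # ls, Semicolon # rs) z)"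
    using assms by (intro exec_scan_right_two) auto
  show ?thesis unfolding skip_section_def
    by (rule exec_mono[OF exec_Seq[OF exec_go_right_two 2]]) simp
qed

text \<open>The unary size is a prefix of both encodings and is copied verbatim. Two sections are
  skipped, because the edges depend on the third partition only.\<close>

definition graph_com :: com where
  "graph_com = copy_while (\<lambda>s. s = One) id ;; skip_section ;; skip_section ;; go 0 MRight ;;
     classes_com ;; move_output"

section \<open>Size of the graph and running time\<close>

fun star_graph :: "pm_triple \<Rightarrow> wgraph" where
  "star_graph (n, Us1, Us2, Us3) = (n, concat (map star Us3))"

lemma enc_set_full: "enc_set n {..<n} = replicate n One"
  by (auto simp: enc_set_def list_eq_iff_nth_eq)

lemma set_enc_set: "set (enc_set n U) \<subseteq> {Zero, One}"
  by (auto simp: enc_set_def)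

lemma length_enc_set [simp]: "length (enc_set n U) = n"
  by (simp add: enc_set_def)

lemma set_enc_classes: "set (enc_classes n Us) \<subseteq> {Comma, Zero, One}"
  using set_enc_set by (induction Us) fastforce+

lemma length_enc_classes: "length (enc_classes n Us) = length Us * (n + 1)"
  by (induction Us) auto

text \<open>An edge takes \<open>n + 5\<close> symbols: semicolon, \<open>n\<close> bits, comma and
  the three symbols of \<open>1/1\<close>. A star inside \<open>{..<n}\<close> has at most
  \<open>n\<close> edges.\<close>

lemma length_star_code:
  assumes "U \<subseteq> {..<n}"
  shows "length (concat (map (enc_edge n) (star U))) \<le> n * (n + 5)"
proof -
  have "length (sorted_list_of_set (U - {Min U})) \<le> n"
    using assms card_mono[of "{..<n}" "U - {Min U}"] by auto
  moreover have "length (concat (map (enc_edge n) (star U)))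
      = length (sorted_list_of_set (U - {Min U})) * (n + 5)"
    by (simp add: star_def length_concat o_def enc_edge_def enc_rat_1 sum_list_triv algebra_simps)
  ultimately show ?thesis by (metis mult_le_mono1)
qed

lemma length_stars_code:
  assumes "\<forall>U\<in>set Us. U \<subseteq> {..<n}"
  shows "length (concat (map (enc_edge n) (concat (map star Us)))) \<le> length Us * (n * (n + 5))"
  using assms
proof (induction Us)
  case (Cons U Us)
  then show ?case using length_star_code[of U n] by simp
qed simp

lemma set_enc_edge_1: "set (enc_edge n (e, 1)) \<subseteq> {Zero, One, Comma, Semicolon, Slash}"
  using set_enc_set[of n e] by (auto simp: enc_edge_def enc_rat_1)

lemma enc_wgraph_edges: "enc_wgraph (n, es) = enc_set n {..<n} @ concat (map (enc_edge n) es)"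
  by (simp add: enc_edge_def)

lemma Blank_notin_star_graph: "Blank \<notin> set (enc_wgraph (star_graph x))"
proof -
  obtain n Us1 Us2 Us3 where x: "x = (n, Us1, Us2, Us3)" by (cases x)
  have "Blank \<notin> set (enc_edge n er)" if "er \<in> set (star U)" for er U
    using that set_enc_edge_1[of n] by (fastforce simp: star_def)
  then show ?thesis using set_enc_set[of n "{..<n}"]
    unfolding x star_graph.simps enc_wgraph_edges by auto
qed

lemma wf_graph_com: "wf_com 2 graph_com"
  by (auto simp: graph_com_def copy_while_def skip_section_def classes_com_def move_output_def go_def
      find_second_def class_loop_def go_back_def emit_edge_def put_def)
    (auto simp: symbols_def)

lemma pm_triple_classes:
  assumes "pm_triple_instance (n, Us1, Us2, Us3)" "Us \<in> {Us1, Us2, Us3}" "U \<in> set Us"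
  shows "U \<noteq> {} \<and> U \<subseteq> {..<n}"
proof -
  have "partition_on {..<n} (set Us)" using assms by auto
  then show ?thesis using assms(3) by (auto simp: partition_on_def)
qed

lemma exec_graph_com:
  assumes x: "pm_triple_instance x"
  shows "\<exists>\<sigma>' ls. exec graph_com (two ([], enc_pm_triple x @ [Blank, Blank]) ([], []))
      (200 * (length (enc_pm_triple x) + 1) ^ 3) \<sigma>' \<and> \<sigma>' 0 = (ls, enc_wgraph (star_graph x) @ [Blank])"
proof -
  obtain n Us1 Us2 Us3 where x_eq: "x = (n, Us1, Us2, Us3)" by (cases x)
  let ?L = "length (enc_pm_triple x)"
  let ?c = "enc_classes n"
  have cl: "\<forall>U\<in>set Us3. U \<noteq> {} \<and> U \<subseteq> {..<n}"
    using x pm_triple_classes[of n Us1 Us2 Us3] by (auto simp: x_eq)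
  have sc: "Semicolon \<notin> set (?c Us)" for Us using set_enc_classes[of n Us] by auto
  define A where "A = ?c Us3 @ [Blank, Blank]"
  define B where "B = ?c Us2 @ Semicolon # A"
  have inp: "enc_pm_triple x @ [Blank, Blank] = replicate n One @ Semicolon # ?c Us1 @ Semicolon # B"
    by (simp add: x_eq enc_set_full A_def B_def)
  have 1: "exec (copy_while (\<lambda>s. s = One) id) (two ([], replicate n One @ Semicolon # ?c Us1 @ Semicolon # B) ([], []))
     (2 * n + 1) (two (replicate n One, Semicolon # ?c Us1 @ Semicolon # B) (replicate n One, []))"
    using exec_copy_while[of "replicate n One" "\<lambda>s. s = One" "Semicolon # ?c Us1 @ Semicolon # B" id "[]" "[]"]
    by simp
  define l1 where "l1 = rev (?c Us1) @ Semicolon # replicate n One"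
  have 2: "exec skip_section (two (replicate n One, Semicolon # ?c Us1 @ Semicolon # B) (replicate n One, []))
     (2 * length (?c Us1) + 3) (two (l1, Semicolon # B) (replicate n One, []))"
    unfolding l1_def by (rule exec_skip_section[OF sc])
  define l2 where "l2 = rev (?c Us2) @ Semicolon # l1"
  have 3: "exec skip_section (two (l1, Semicolon # B) (replicate n One, []))
     (2 * length (?c Us2) + 3) (two (l2, Semicolon # A) (replicate n One, []))"
    unfolding l2_def B_def by (rule exec_skip_section[OF sc])
  let ?v = "concat (map (enc_edge n) (concat (map star Us3)))"
  obtain l3 where 4: "exec classes_com (two (Semicolon # l2, A) (replicate n One, []))
    (length Us3 * ((n + 1) * (8 * n + 50) + 1) + 1)
    (two (l3, [Blank, Blank]) (rev ?v @ replicate n One, []))"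
    using exec_classes[OF cl, of "Semicolon # l2" "[Blank]" "replicate n One"] unfolding A_def by auto
  let ?w = "enc_wgraph (star_graph x)"
  have w: "?w = replicate n One @ ?v"
    unfolding x_eq star_graph.simps enc_wgraph_edges enc_set_full ..
  obtain l4 z where 5: "exec move_output (two (l3, [Blank, Blank]) (rev ?w, [])) (2 * length ?w + 5)
    (two (l4, ?w @ [Blank]) z)"
    using exec_move_output[OF Blank_notin_star_graph[of x], of l3 Blank "[Blank]"] by auto
  have rw: "rev ?w = rev ?v @ replicate n One" unfolding w by simp
  note run = exec_Seq[OF 1 exec_Seq[OF 2 exec_Seq[OF 3 exec_Seq[OF exec_go_right_two exec_Seq[OF 4 5[unfolded rw]]]]]]
  have L: "?L = n + length Us1 * (n + 1) + length Us2 * (n + 1) + length Us3 * (n + 1) + 3"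
    by (simp add: x_eq length_enc_classes)
  \<comment> \<open>Each class occupies \<open>n + 1\<close> symbols and the ground set is written
    in unary, so both quantities are bounded by the input length.\<close>
  have U3: "length Us3 \<le> ?L" and nL: "n \<le> ?L"
    using L by (auto simp: algebra_simps)
  have secs: "length (?c Us1) \<le> ?L" "length (?c Us2) \<le> ?L"
    using L by (auto simp: length_enc_classes)
  have "length ?v \<le> length Us3 * (n * (n + 5))"
    using cl by (intro length_stars_code) auto
  also have "\<dots> \<le> ?L * (?L * (?L + 5))" using U3 nL by (intro mult_le_mono) auto
  finally have v: "length ?w \<le> ?L + ?L * (?L * (?L + 5))" using nL unfolding w by simp
  have m: "length Us3 * ((n + 1) * (8 * n + 50) + 1) \<le> ?L * ((?L + 1) * (8 * ?L + 50) + 1)"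
    using U3 nL by (intro mult_le_mono add_le_mono) auto
  \<comment> \<open>Expanded, the left side is \<open>10 * N^3 + 68 * N^2 + 63 * N + 40\<close>; the
    constant 200 is generous. The cubic term comes from N classes, at most N rounds for each and a
    linear cost per round, and from the length of the output.\<close>
  have poly: "10 * N + N * ((N + 1) * (8 * N + 50) + 1) + 2 * (N + N * (N * (N + 5))) + 40 \<le> 200 * (N + 1) ^ 3" for N :: nat
    by (simp add: power3_eq_cube algebra_simps)
  have sum_bound: "2 * a + 1 + (2 * s + 3 + (2 * t + 3 + (1 + (q + 1 + (2 * w + 5) + 1) + 1) + 1) + 1) + 1 \<le> R"
    if "a \<le> N" "s \<le> N" "t \<le> N" "q \<le> Q" "w \<le> W" "10 * N + Q + 2 * W + 40 \<le> R"
    for a s t q w N Q W R :: nat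
    using that by linarith
  have "exec graph_com (two ([], enc_pm_triple x @ [Blank, Blank]) ([], []))
      (200 * (?L + 1) ^ 3) (two (l4, ?w @ [Blank]) z)"
    unfolding graph_com_def inp
    by (rule exec_mono[OF run]) (rule sum_bound[OF nL secs m v poly])
  then show ?thesis by (intro exI[of _ "two (l4, ?w @ [Blank]) z"] exI[of _ l4]) simp
qed

lemma polytime_star_graph:
  "polytime_computable (Collect pm_triple_instance) enc_pm_triple enc_wgraph star_graph"
proof (rule polytime_computable_exec[OF wf_graph_com, where c = 200 and d = 3])
  fix x assume "x \<in> Collect pm_triple_instance"
  moreover have "initial (two ([], u @ [Blank, Blank]) ([], [])) u" for u
    using represents_word_tape[of 0 u 2] represents_word_tape[of 0 "[]" 0]
    by (auto simp: initial_def two_def numeral_2_eq_2)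
  ultimately show "\<exists>\<sigma> \<sigma>' ls rs. initial \<sigma> (enc_pm_triple x) \<and>
        exec graph_com \<sigma> (200 * (length (enc_pm_triple x) + 1) ^ 3) \<sigma>' \<and>
        \<sigma>' 0 = (ls, enc_wgraph (star_graph x) @ Blank # rs)"
    using exec_graph_com by (metis mem_Collect_eq)
qed (use Blank_notin_star_graph in auto)

section \<open>Answering oracle queries\<close>

text \<open>Tape 0 holds the input and tape 1 the query. Tapes 2 and 3 are one-cell registers: the current
  class has met the query; some checked class has met it twice. The classes of the three
  partitions are counted in unary on tapes 4, 5 and 6.\<close>

definition st :: "zipper \<Rightarrow> zipper \<Rightarrow> zipper \<Rightarrow> zipper \<Rightarrow> store \<Rightarrow> store" where
  "st z0 z1 z2 z3 \<rho> = (\<lambda>i. if i = 0 then z0 else if i = 1 then z1 else if i = 2 then z2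
     else if i = 3 then z3 else \<rho> i)"

lemma st_simps [simp]:
  "st z0 z1 z2 z3 \<rho> 0 = z0" "st z0 z1 z2 z3 \<rho> (Suc 0) = z1" "st z0 z1 z2 z3 \<rho> 2 = z2"
  "st z0 z1 z2 z3 \<rho> 3 = z3"
  "(st z0 z1 z2 z3 \<rho>)(0 := z) = st z z1 z2 z3 \<rho>" "(st z0 z1 z2 z3 \<rho>)(Suc 0 := z) = st z0 z z2 z3 \<rho>"
  "(st z0 z1 z2 z3 \<rho>)(2 := z) = st z0 z1 z z3 \<rho>" "(st z0 z1 z2 z3 \<rho>)(3 := z) = st z0 z1 z2 z \<rho>"
  by (auto simp: st_def)

lemma st_counter [simp]:
  assumes "4 \<le> c"
  shows "st z0 z1 z2 z3 \<rho> c = \<rho> c" "(st z0 z1 z2 z3 \<rho>)(c := z) = st z0 z1 z2 z3 (\<rho>(c := z))"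
  using assms by (auto simp: st_def)

section \<open>Fetching the query\<close>

text \<open>The query is what follows the last semicolon, so it is fetched from the right end of the
  input. On tape 1 it ends up between two blanks, which serve as stops whenever that tape is rewound
  or scanned; tape 0 returns to its start.\<close>

definition fetch_query :: com where
  "fetch_query = While (\<lambda>r. r 0 \<noteq> Blank) (go 0 MRight) ;;
     Act [(0, \<lambda>r. (r 0, MLeft)), (1, \<lambda>r. (Blank, MLeft))] ;;
     While (\<lambda>r. r 0 \<noteq> Semicolon) (Act [(0, \<lambda>r. (r 0, MLeft)), (1, \<lambda>r. (r 0, MLeft))]) ;;
     go 0 MLeft ;; While (\<lambda>r. r 0 \<noteq> Blank) (go 0 MLeft) ;; go 0 MRight"

lemma exec_fetch_loop:
  assumes "Semicolon \<notin> set xs"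
  shows "exec (While (\<lambda>r. r 0 \<noteq> Semicolon) (Act [(0, \<lambda>r. (r 0, MLeft)), (1, \<lambda>r. (r 0, MLeft))]))
    (st (at_left (xs @ Semicolon # ls) rs) ([], Blank # zs) z2 z3 \<rho>) (2 * length xs + 1)
    (st (ls, Semicolon # rev xs @ rs) ([], Blank # rev xs @ zs) z2 z3 \<rho>)"
  using assms
proof (induction xs arbitrary: rs zs)
  case Nil
  show ?case using exec_While_False[of "\<lambda>r. r 0 \<noteq> Semicolon"
      "st (ls, Semicolon # rs) ([], Blank # zs) z2 z3 \<rho>"] by simp
next
  case (Cons x xs)
  let ?p = "Act [(0, \<lambda>r. (r 0, MLeft)), (1, \<lambda>r. (r 0, MLeft))]"
  have 1: "exec ?p (st (at_left ((x # xs) @ Semicolon # ls) rs) ([], Blank # zs) z2 z3 \<rho>) 1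
      (st (at_left (xs @ Semicolon # ls) (x # rs)) ([], Blank # x # zs) z2 z3 \<rho>)"
    by (rule exec_Act) (simp add: at_left_def[of "[]"])
  note 2 = Cons.IH[of "x # rs" "x # zs"]
  show ?case
    by (rule exec_mono) (use exec_While_True[OF _ 1 2] Cons.prems in auto)
qed

lemma exec_fetch_query:
  assumes "Blank \<notin> set pre" "Blank \<notin> set q" "Semicolon \<notin> set q"
  defines "z \<equiv> ([Blank], pre @ Semicolon # q @ [Blank])"
  shows "exec fetch_query (st z ([], [Blank]) z2 z3 \<rho>) (4 * length pre + 4 * length q + 20)
    (st z ([], Blank # q @ [Blank]) z2 z3 \<rho>)"
proof -
  let ?u = "pre @ Semicolon # q"
  have 1: "exec (While (\<lambda>r. r 0 \<noteq> Blank) (go 0 MRight)) (st z ([], [Blank]) z2 z3 \<rho>)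
      (2 * length ?u + 1) (st (rev ?u @ [Blank], [Blank]) ([], [Blank]) z2 z3 \<rho>)"
    using exec_scan_right[of "st z ([], [Blank]) z2 z3 \<rho>" 0 "[Blank]" ?u "[Blank]" "\<lambda>s. s \<noteq> Blank"]
      assms by auto
  have 2: "exec (Act [(0, \<lambda>r. (r 0, MLeft)), (1, \<lambda>r. (Blank, MLeft))])
      (st (rev ?u @ [Blank], [Blank]) ([], [Blank]) z2 z3 \<rho>) 1
      (st (at_left (rev q @ Semicolon # rev pre @ [Blank]) [Blank]) ([], Blank # [Blank]) z2 z3 \<rho>)"
    by (rule exec_Act) (simp add: at_left_def[of "[]"])
  have 3: "exec (While (\<lambda>r. r 0 \<noteq> Semicolon) (Act [(0, \<lambda>r. (r 0, MLeft)), (1, \<lambda>r. (r 0, MLeft))]))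
      (st (at_left (rev q @ Semicolon # rev pre @ [Blank]) [Blank]) ([], Blank # [Blank]) z2 z3 \<rho>)
      (2 * length q + 1)
      (st (rev pre @ [Blank], Semicolon # q @ [Blank]) ([], Blank # q @ [Blank]) z2 z3 \<rho>)"
    using exec_fetch_loop[of "rev q" "rev pre @ [Blank]" "[Blank]" "[Blank]"] assms by simp
  have 4: "exec (go 0 MLeft) (st (rev pre @ [Blank], Semicolon # q @ [Blank]) ([], Blank # q @ [Blank]) z2 z3 \<rho>) 1
     (st (at_left (rev pre @ [Blank]) (Semicolon # q @ [Blank])) ([], Blank # q @ [Blank]) z2 z3 \<rho>)"
    using exec_go[of 0 MLeft "st (rev pre @ [Blank], Semicolon # q @ [Blank]) ([], Blank # q @ [Blank]) z2 z3 \<rho>"]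
    by simp
  have 5: "exec (While (\<lambda>r. r 0 \<noteq> Blank) (go 0 MLeft))
     (st (at_left (rev pre @ [Blank]) (Semicolon # q @ [Blank])) ([], Blank # q @ [Blank]) z2 z3 \<rho>)
     (2 * length pre + 1)
     (st ([], Blank # pre @ Semicolon # q @ [Blank]) ([], Blank # q @ [Blank]) z2 z3 \<rho>)"
    using exec_scan_left[of "st (at_left (rev pre @ [Blank]) (Semicolon # q @ [Blank]))
         ([], Blank # q @ [Blank]) z2 z3 \<rho>" 0 "rev pre" Blank "[]" _ "\<lambda>s. s \<noteq> Blank"] assms by auto
  have 6: "exec (go 0 MRight) (st ([], Blank # pre @ Semicolon # q @ [Blank]) ([], Blank # q @ [Blank]) z2 z3 \<rho>) 1
     (st z ([], Blank # q @ [Blank]) z2 z3 \<rho>)"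
    using exec_go[of 0 MRight "st ([], Blank # pre @ Semicolon # q @ [Blank]) ([], Blank # q @ [Blank]) z2 z3 \<rho>"]
    by (simp add: z_def)
  show ?thesis unfolding fetch_query_def
    by (rule exec_mono[OF exec_Seq[OF 1 exec_Seq[OF 2 exec_Seq[OF 3 exec_Seq[OF 4 exec_Seq[OF 5 6]]]]]]) simp
qed

section \<open>Testing the classes against the query\<close>

text \<open>With \<open>Blank\<close> for \<open>False\<close>, an untouched tape is a register that
  holds \<open>False\<close>.\<close>

definition reg :: "bool \<Rightarrow> zipper" where
  "reg b = ([], [if b then One else Blank])"

definition hits :: "sym list \<Rightarrow> sym list \<Rightarrow> nat" where
  "hits xs ys = length (filter (\<lambda>(x, y). x = One \<and> y = One) (zip xs ys))"

text \<open>All actions see the old content of tape 2, so tape 3 is set by a second hit in the class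
  but not by the first. With \<open>chk\<close> false, tape 3 keeps its value and the class is
  merely passed over.\<close>

definition check_bits :: "bool \<Rightarrow> com" where
  "check_bits chk = While (\<lambda>r. r 0 = Zero \<or> r 0 = One)
     (Act [(0, \<lambda>r. (r 0, MRight)), (1, \<lambda>r. (r 1, MRight)),
       (2, \<lambda>r. (if r 0 = One \<and> r 1 = One then One else r 2, Stay)),
       (3, \<lambda>r. (if chk \<and> r 0 = One \<and> r 1 = One \<and> r 2 = One then One else r 3, Stay))])"

text \<open>The register value \<open>s\<close> stands for a hit at an earlier position; the
  induction over the positions needs it general, although a class starts with
  \<open>s = False\<close>.\<close>

lemma exec_check_bits:
  assumes "length xs = length ys" "set xs \<subseteq> {Zero, One}" "hd_blank rs \<notin> {Zero, One}"
  shows "exec (check_bits chk) (st (ls, xs @ rs) (ms, ys @ ns) (reg s) (reg b) \<rho>) (2 * length xs + 1)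
    (st (rev xs @ ls, rs) (rev ys @ ms, ns) (reg (s \<or> hits xs ys \<ge> 1))
      (reg (b \<or> chk \<and> (hits xs ys \<ge> 2 \<or> s \<and> hits xs ys \<ge> 1))) \<rho>)"
  using assms unfolding check_bits_def
proof (induction xs ys arbitrary: ls ms s b rule: list_induct2)
  case Nil
  then show ?case using exec_While_False[of "\<lambda>r. r 0 = Zero \<or> r 0 = One"] by (simp add: hits_def)
next
  case (Cons x xs y ys)
  let ?h = "x = One \<and> y = One"
  let ?p = "Act [(0, \<lambda>r. (r 0, MRight)), (1, \<lambda>r. (r 1, MRight)),
       (2, \<lambda>r. (if r 0 = One \<and> r 1 = One then One else r 2, Stay)),
       (3, \<lambda>r. (if chk \<and> r 0 = One \<and> r 1 = One \<and> r 2 = One then One else r 3, Stay))]"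
  have 1: "exec ?p (st (ls, (x # xs) @ rs) (ms, (y # ys) @ ns) (reg s) (reg b) \<rho>) 1
     (st (x # ls, xs @ rs) (y # ms, ys @ ns) (reg (s \<or> ?h)) (reg (b \<or> chk \<and> s \<and> ?h)) \<rho>)"
    by (rule exec_Act) (auto simp: reg_def)
  have h: "hits (x # xs) (y # ys) = (if ?h then 1 else 0) + hits xs ys" by (simp add: hits_def)
  have r: "reg ((s \<or> ?h) \<or> hits xs ys \<ge> 1) = reg (s \<or> hits (x # xs) (y # ys) \<ge> 1)"
    "reg ((b \<or> chk \<and> s \<and> ?h) \<or> chk \<and> (hits xs ys \<ge> 2 \<or> (s \<or> ?h) \<and> hits xs ys \<ge> 1))
     = reg (b \<or> chk \<and> (hits (x # xs) (y # ys) \<ge> 2 \<or> s \<and> hits (x # xs) (y # ys) \<ge> 1))"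
    unfolding h by (rule arg_cong[of _ _ reg], auto)+
  have 2: "exec (While (\<lambda>r. r 0 = Zero \<or> r 0 = One) ?p)
     (st (x # ls, xs @ rs) (y # ms, ys @ ns) (reg (s \<or> ?h)) (reg (b \<or> chk \<and> s \<and> ?h)) \<rho>)
     (2 * length xs + 1) (st (rev (x # xs) @ ls, rs) (rev (y # ys) @ ms, ns)
     (reg (s \<or> hits (x # xs) (y # ys) \<ge> 1))
     (reg (b \<or> chk \<and> (hits (x # xs) (y # ys) \<ge> 2 \<or> s \<and> hits (x # xs) (y # ys) \<ge> 1))) \<rho>)"
    using Cons.IH[of "x # ls" "y # ms" "s \<or> ?h" "b \<or> chk \<and> s \<and> ?h"] Cons.prems
    unfolding r by simp
  show ?case
    by (rule exec_mono[OF exec_While_True[OF _ 1 2]]) (use Cons.prems in auto)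
qed

text \<open>Besides the test it prepares the next class: register 2 is cleared on entry, one tally
  mark is added on tape \<open>c\<close>, and tape 1 is rewound to the blank before the
  query.\<close>

definition check_class :: "nat \<Rightarrow> bool \<Rightarrow> com" where
  "check_class c chk = Act [(0, \<lambda>r. (r 0, MRight)), (1, \<lambda>r. (r 1, MRight)),
       (2, \<lambda>r. (Blank, Stay)), (c, \<lambda>r. (One, MRight))] ;;
     check_bits chk ;; go 1 MLeft ;; While (\<lambda>r. r 1 \<noteq> Blank) (go 1 MLeft)"

lemma exec_check_class:
  assumes "length xs = length q" "set xs \<subseteq> {Zero, One}" "hd_blank rs \<notin> {Zero, One}"
    and "Blank \<notin> set q" and c: "4 \<le> c" "\<rho> c = (ks, [])"
  shows "exec (check_class c chk)
    (st (ls, Comma # xs @ rs) ([], Blank # q @ [Blank]) (reg s) (reg b) \<rho>) (4 * length q + 8)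
    (st (rev xs @ Comma # ls, rs) ([], Blank # q @ [Blank]) (reg (hits xs q \<ge> 1))
       (reg (b \<or> chk \<and> hits xs q \<ge> 2)) (\<rho>(c := (One # ks, []))))"
proof -
  let ?\<rho> = "\<rho>(c := (One # ks, []))"
  let ?r2 = "reg (hits xs q \<ge> 1)" and ?r3 = "reg (b \<or> chk \<and> hits xs q \<ge> 2)"
  have 1: "exec (Act [(0, \<lambda>r. (r 0, MRight)), (1, \<lambda>r. (r 1, MRight)),
       (2, \<lambda>r. (Blank, Stay)), (c, \<lambda>r. (One, MRight))])
     (st (ls, Comma # xs @ rs) ([], Blank # q @ [Blank]) (reg s) (reg b) \<rho>) 1
     (st (Comma # ls, xs @ rs) ([Blank], q @ [Blank]) (reg False) (reg b) ?\<rho>)"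
    by (rule exec_Act) (use c in \<open>simp add: reg_def\<close>)
  have 2: "exec (check_bits chk) (st (Comma # ls, xs @ rs) ([Blank], q @ [Blank]) (reg False) (reg b) ?\<rho>)
     (2 * length xs + 1) (st (rev xs @ Comma # ls, rs) (rev q @ [Blank], [Blank]) ?r2 ?r3 ?\<rho>)"
    using exec_check_bits[OF assms(1-3), of chk "Comma # ls" "[Blank]" "[Blank]" False b ?\<rho>] by simp
  have 3: "exec (go 1 MLeft) (st (rev xs @ Comma # ls, rs) (rev q @ [Blank], [Blank]) ?r2 ?r3 ?\<rho>) 1
     (st (rev xs @ Comma # ls, rs) (at_left (rev q @ [Blank]) [Blank]) ?r2 ?r3 ?\<rho>)"
    using exec_go[of 1 MLeft "st (rev xs @ Comma # ls, rs) (rev q @ [Blank], [Blank]) ?r2 ?r3 ?\<rho>"] by simp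
  have 4: "exec (While (\<lambda>r. r 1 \<noteq> Blank) (go 1 MLeft))
     (st (rev xs @ Comma # ls, rs) (at_left (rev q @ [Blank]) [Blank]) ?r2 ?r3 ?\<rho>) (2 * length q + 1)
     (st (rev xs @ Comma # ls, rs) ([], Blank # q @ [Blank]) ?r2 ?r3 ?\<rho>)"
    using exec_scan_left[of "st (rev xs @ Comma # ls, rs) (at_left (rev q @ [Blank]) [Blank]) ?r2 ?r3 ?\<rho>"
      1 "rev q" Blank "[]" "[Blank]" "\<lambda>s. s \<noteq> Blank"] assms(4) by auto
  show ?thesis unfolding check_class_def
    by (rule exec_mono[OF exec_Seq[OF 1 exec_Seq[OF 2 exec_Seq[OF 3 4]]]]) (use assms(1) in simp)
qed

definition check_section :: "nat \<Rightarrow> bool \<Rightarrow> com" where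
  "check_section c chk = go 0 MRight ;; While (\<lambda>r. r 0 = Comma) (check_class c chk)"

text \<open>The content of register 2 stays existential, since each class clears it on entry;
  register 3 and the tally on tape \<open>c\<close> carry the result.\<close>

lemma exec_check_classes:
  assumes "4 \<le> c" "\<rho> c = (ks, [])" "length q = n" "Blank \<notin> set q"
  shows "\<exists>s'. exec (While (\<lambda>r. r 0 = Comma) (check_class c chk))
    (st (ls, enc_classes n Us @ Semicolon # rs) ([], Blank # q @ [Blank]) (reg s) (reg b) \<rho>)
    (length Us * (4 * n + 9) + 1)
    (st (rev (enc_classes n Us) @ ls, Semicolon # rs) ([], Blank # q @ [Blank]) (reg s')
      (reg (b \<or> chk \<and> (\<exists>U\<in>set Us. hits (enc_set n U) q \<ge> 2)))
      (\<rho>(c := (replicate (length Us) One @ ks, []))))"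
  using assms(2)
proof (induction Us arbitrary: ls s b \<rho> ks)
  case Nil
  then have "\<rho>(c := (ks, [])) = \<rho>" by auto
  moreover have "exec (While (\<lambda>r. r 0 = Comma) (check_class c chk))
    (st (ls, Semicolon # rs) ([], Blank # q @ [Blank]) (reg s) (reg b) \<rho>) 1
    (st (ls, Semicolon # rs) ([], Blank # q @ [Blank]) (reg s) (reg b) \<rho>)"
    by (rule exec_While_False) simp
  ultimately show ?case by (auto simp del: fun_upd_apply)
next
  case (Cons U Us)
  let ?u = "enc_set n U" and ?\<rho> = "\<rho>(c := (One # ks, []))" and ?b = "b \<or> chk \<and> hits (enc_set n U) q \<ge> 2"
  let ?rest = "enc_classes n Us @ Semicolon # rs"
  have h: "hd_blank ?rest \<notin> {Zero, One}" by (cases Us) auto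
  have 1: "exec (check_class c chk)
     (st (ls, Comma # ?u @ ?rest) ([], Blank # q @ [Blank]) (reg s) (reg b) \<rho>) (4 * n + 8)
     (st (rev ?u @ Comma # ls, ?rest) ([], Blank # q @ [Blank]) (reg (hits ?u q \<ge> 1)) (reg ?b) ?\<rho>)"
    using exec_check_class[where \<rho> = \<rho>, OF _ set_enc_set h assms(4,1) Cons.prems] assms(3) by simp
  obtain s' where 2: "exec (While (\<lambda>r. r 0 = Comma) (check_class c chk))
    (st (rev ?u @ Comma # ls, ?rest) ([], Blank # q @ [Blank]) (reg (hits ?u q \<ge> 1)) (reg ?b) ?\<rho>)
    (length Us * (4 * n + 9) + 1)
    (st (rev (enc_classes n Us) @ rev ?u @ Comma # ls, Semicolon # rs) ([], Blank # q @ [Blank]) (reg s')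
      (reg (?b \<or> chk \<and> (\<exists>U\<in>set Us. hits (enc_set n U) q \<ge> 2)))
      (?\<rho>(c := (replicate (length Us) One @ One # ks, []))))"
    using Cons.IH[of ?\<rho> "One # ks" "rev ?u @ Comma # ls" "hits ?u q \<ge> 1" ?b, OF fun_upd_same] by (elim exE)
  have 3: "exec (While (\<lambda>r. r 0 = Comma) (check_class c chk))
    (st (ls, Comma # ?u @ ?rest) ([], Blank # q @ [Blank]) (reg s) (reg b) \<rho>)
    (length (U # Us) * (4 * n + 9) + 1)
    (st (rev (enc_classes n Us) @ rev ?u @ Comma # ls, Semicolon # rs) ([], Blank # q @ [Blank]) (reg s')
      (reg (?b \<or> chk \<and> (\<exists>U\<in>set Us. hits (enc_set n U) q \<ge> 2)))
      (?\<rho>(c := (replicate (length Us) One @ One # ks, []))))"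
    by (rule exec_mono[OF exec_While_True[OF _ 1 2]]) auto
  have r: "reg (?b \<or> chk \<and> (\<exists>U\<in>set Us. hits (enc_set n U) q \<ge> 2))
     = reg (b \<or> chk \<and> (\<exists>U\<in>set (U # Us). hits (enc_set n U) q \<ge> 2))"
    by (rule arg_cong[of _ _ reg]) auto
  show ?case using 3 unfolding r
    by (intro exI[of _ s']) (simp add: replicate_app_Cons_same del: fun_upd_apply)
qed

lemma exec_check_section:
  assumes "4 \<le> c" "\<rho> c = ([], [])" "length q = n" "Blank \<notin> set q"
  shows "\<exists>s'. exec (check_section c chk)
    (st (ls, y # enc_classes n Us @ Semicolon # rs) ([], Blank # q @ [Blank]) (reg s) (reg b) \<rho>)
    (length Us * (4 * n + 9) + 3)
    (st (rev (enc_classes n Us) @ y # ls, Semicolon # rs) ([], Blank # q @ [Blank]) (reg s')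
      (reg (b \<or> chk \<and> (\<exists>U\<in>set Us. hits (enc_set n U) q \<ge> 2)))
      (\<rho>(c := (replicate (length Us) One, []))))"
proof -
  have 1: "exec (go 0 MRight)
      (st (ls, y # enc_classes n Us @ Semicolon # rs) ([], Blank # q @ [Blank]) (reg s) (reg b) \<rho>) 1
      (st (y # ls, enc_classes n Us @ Semicolon # rs) ([], Blank # q @ [Blank]) (reg s) (reg b) \<rho>)"
    using exec_go[of 0 MRight "st (ls, y # enc_classes n Us @ Semicolon # rs) ([], Blank # q @ [Blank]) (reg s) (reg b) \<rho>"]
    by simp
  obtain s' where 2: "exec (While (\<lambda>r. r 0 = Comma) (check_class c chk))
    (st (y # ls, enc_classes n Us @ Semicolon # rs) ([], Blank # q @ [Blank]) (reg s) (reg b) \<rho>)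
    (length Us * (4 * n + 9) + 1)
    (st (rev (enc_classes n Us) @ y # ls, Semicolon # rs) ([], Blank # q @ [Blank]) (reg s')
      (reg (b \<or> chk \<and> (\<exists>U\<in>set Us. hits (enc_set n U) q \<ge> 2)))
      (\<rho>(c := (replicate (length Us) One @ [], []))))"
    using exec_check_classes[where \<rho> = \<rho>, OF assms, of chk "y # ls" Us rs s b] by blast
  show ?thesis unfolding check_section_def
    by (rule exI[of _ s']) (rule exec_mono[OF exec_Seq[OF 1 2[unfolded append_Nil2]]], simp)
qed

section \<open>Comparing the three numbers of classes\<close>

definition counters_left :: com where
  "counters_left = Act [(4, \<lambda>r. (r 4, MLeft)), (5, \<lambda>r. (r 5, MLeft)), (6, \<lambda>r. (r 6, MLeft))]"

definition compare_counters :: com where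
  "compare_counters = counters_left ;;
     While (\<lambda>r. r 4 = One \<and> r 5 = One \<and> r 6 = One) counters_left"

text \<open>The three tallies are consumed in parallel until one runs out; they are equal exactly if
  all three heads then see a blank. The outcome is thus stored in the head positions, where
  \<open>answer\<close> reads it.\<close>

lemma exec_compare_loop:
  assumes "\<rho> 4 = at_left (replicate a One) u" "\<rho> 5 = at_left (replicate b One) v"
    "\<rho> 6 = at_left (replicate c One) w"
  shows "\<exists>\<rho>'. exec (While (\<lambda>r. r 4 = One \<and> r 5 = One \<and> r 6 = One) counters_left)
      (st z0 z1 z2 z3 \<rho>) (2 * a + 1) (st z0 z1 z2 z3 \<rho>') \<and>
    ((reads \<rho>' 4 = Blank \<and> reads \<rho>' 5 = Blank \<and> reads \<rho>' 6 = Blank) \<longleftrightarrow> a = b \<and> b = c)"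
  using assms
proof (induction a arbitrary: b c \<rho> u v w)
  case 0
  have "exec (While (\<lambda>r. r 4 = One \<and> r 5 = One \<and> r 6 = One) counters_left)
      (st z0 z1 z2 z3 \<rho>) 1 (st z0 z1 z2 z3 \<rho>)"
    by (rule exec_While_False) (use 0 in \<open>simp add: at_left_def\<close>)
  then show ?case using 0 by (intro exI[of _ \<rho>]) (cases b; cases c; auto simp: at_left_def)
next
  case (Suc a)
  show ?case
  proof (cases "b = 0 \<or> c = 0")
    case True
    have "exec (While (\<lambda>r. r 4 = One \<and> r 5 = One \<and> r 6 = One) counters_left)
        (st z0 z1 z2 z3 \<rho>) 1 (st z0 z1 z2 z3 \<rho>)"
      by (rule exec_While_False) (use Suc.prems True in \<open>auto simp: at_left_def\<close>)
    then have "exec (While (\<lambda>r. r 4 = One \<and> r 5 = One \<and> r 6 = One) counters_left)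
        (st z0 z1 z2 z3 \<rho>) (2 * Suc a + 1) (st z0 z1 z2 z3 \<rho>)"
      by (rule exec_mono) simp
    then show ?thesis using Suc.prems True by (intro exI[of _ \<rho>]) auto
  next
    case False
    then obtain b' c' where bc: "b = Suc b'" "c = Suc c'" by (auto simp: gr0_conv_Suc)
    let ?\<rho> = "\<rho>(4 := at_left (replicate a One) (One # u), 5 := at_left (replicate b' One) (One # v),
       6 := at_left (replicate c' One) (One # w))"
    have 1: "exec counters_left (st z0 z1 z2 z3 \<rho>) 1 (st z0 z1 z2 z3 ?\<rho>)"
      unfolding counters_left_def
      by (rule exec_Act) (use Suc.prems bc in \<open>simp add: fun_upd_twist\<close>)
    have upd: "?\<rho> 4 = at_left (replicate a One) (One # u)" "?\<rho> 5 = at_left (replicate b' One) (One # v)"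
      "?\<rho> 6 = at_left (replicate c' One) (One # w)" by simp_all
    obtain \<rho>' where 2: "exec (While (\<lambda>r. r 4 = One \<and> r 5 = One \<and> r 6 = One) counters_left)
        (st z0 z1 z2 z3 ?\<rho>) (2 * a + 1) (st z0 z1 z2 z3 \<rho>')"
      and 3: "(reads \<rho>' 4 = Blank \<and> reads \<rho>' 5 = Blank \<and> reads \<rho>' 6 = Blank) \<longleftrightarrow> a = b' \<and> b' = c'"
      using Suc.IH[of ?\<rho>, OF upd] by (elim exE conjE)
    have "exec (While (\<lambda>r. r 4 = One \<and> r 5 = One \<and> r 6 = One) counters_left)
        (st z0 z1 z2 z3 \<rho>) (2 * Suc a + 1) (st z0 z1 z2 z3 \<rho>')"
      by (rule exec_mono[OF exec_While_True[OF _ 1 2]]) (use Suc.prems bc in auto)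
    then show ?thesis using 3 bc by (intro exI[of _ \<rho>']) auto
  qed
qed

lemma exec_compare_counters:
  assumes "\<rho> 4 = (replicate a One, [])" "\<rho> 5 = (replicate b One, [])" "\<rho> 6 = (replicate c One, [])"
  shows "\<exists>\<rho>'. exec compare_counters (st z0 z1 z2 z3 \<rho>) (2 * a + 3) (st z0 z1 z2 z3 \<rho>') \<and>
    ((reads \<rho>' 4 = Blank \<and> reads \<rho>' 5 = Blank \<and> reads \<rho>' 6 = Blank) \<longleftrightarrow> a = b \<and> b = c)"
proof -
  let ?\<rho> = "\<rho>(4 := at_left (replicate a One) [Blank], 5 := at_left (replicate b One) [Blank],
       6 := at_left (replicate c One) [Blank])"
  have 1: "exec counters_left (st z0 z1 z2 z3 \<rho>) 1 (st z0 z1 z2 z3 ?\<rho>)"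
    unfolding counters_left_def by (rule exec_Act) (use assms in \<open>simp add: fun_upd_twist\<close>)
  have upd: "?\<rho> 4 = at_left (replicate a One) [Blank]" "?\<rho> 5 = at_left (replicate b One) [Blank]"
    "?\<rho> 6 = at_left (replicate c One) [Blank]" by simp_all
  obtain \<rho>' where 2: "exec (While (\<lambda>r. r 4 = One \<and> r 5 = One \<and> r 6 = One) counters_left)
        (st z0 z1 z2 z3 ?\<rho>) (2 * a + 1) (st z0 z1 z2 z3 \<rho>')"
    and 3: "(reads \<rho>' 4 = Blank \<and> reads \<rho>' 5 = Blank \<and> reads \<rho>' 6 = Blank) \<longleftrightarrow> a = b \<and> b = c"
    using exec_compare_loop[OF upd, of z0 z1 z2 z3] by (elim exE conjE)
  have "exec compare_counters (st z0 z1 z2 z3 \<rho>) (2 * a + 3) (st z0 z1 z2 z3 \<rho>')"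
    unfolding compare_counters_def by (rule exec_mono[OF exec_Seq[OF 1 2]]) simp
  then show ?thesis using 3 by blast
qed

definition answer :: com where
  "answer = go 1 MRight ;; While (\<lambda>r. r 1 = Zero) (go 1 MRight) ;; go 0 MRight ;;
     Act [(0, \<lambda>r. (Blank, MLeft))] ;;
     Act [(0, \<lambda>r. (if r 1 = Blank \<or> r 3 = Blank \<and> r 4 = Blank \<and> r 5 = Blank \<and> r 6 = Blank
                   then One else Zero, Stay))]"

text \<open>After the leading zeros, tape 1 shows a blank exactly if the query is the empty set,
  which is independent in either form of the matroid. The blank written to the right of the answer
  cell cuts the output down to one symbol.\<close>

lemma exec_answer:
  assumes q: "set q \<subseteq> {Zero, One}"
    and eq: "(reads \<rho> 4 = Blank \<and> reads \<rho> 5 = Blank \<and> reads \<rho> 6 = Blank) \<longleftrightarrow> e"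
  shows "\<exists>ls' rs' z. exec answer (st (ls, Semicolon # q @ [Blank]) ([], Blank # q @ [Blank]) z2 (reg b) \<rho>)
    (2 * length q + 20)
    (st (ls', enc_bool (One \<notin> set q \<or> \<not> b \<and> e) @ Blank # rs') z z2 (reg b) \<rho>)"
proof -
  define t d where "t = takeWhile (\<lambda>s. s = Zero) q" and "d = dropWhile (\<lambda>s. s = Zero) q @ [Blank]"
  have tq: "q @ [Blank] = t @ d" by (simp add: t_def d_def)
  have t: "\<forall>s\<in>set t. s = Zero" "length t \<le> length q"
    by (auto simp: t_def length_takeWhile_le dest: set_takeWhileD)
  have d: "hd_blank d \<noteq> Zero" "hd_blank d = Blank \<longleftrightarrow> One \<notin> set q"
    unfolding d_def using q by (induction q) auto
  let ?y = "(Semicolon # ls, q @ [Blank])"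
  let ?s = "\<lambda>z0 z1. st z0 z1 z2 (reg b) \<rho>"
  let ?z0 = "(ls, Semicolon # q @ [Blank])" and ?z1 = "(rev t @ [Blank], d)"
  have 1: "exec (go 1 MRight) (?s ?z0 ([], Blank # q @ [Blank])) 1 (?s ?z0 ([Blank], q @ [Blank]))"
    using exec_go[of 1 MRight "?s ?z0 ([], Blank # q @ [Blank])"] by simp
  have 2: "exec (While (\<lambda>r. r 1 = Zero) (go 1 MRight)) (?s ?z0 ([Blank], q @ [Blank])) (2 * length t + 1)
     (?s ?z0 ?z1)"
    using exec_scan_right[of "?s ?z0 ([Blank], q @ [Blank])" 1 "[Blank]" t d "\<lambda>s. s = Zero"] tq t(1) d(1)
    by simp
  have 3: "exec (go 0 MRight) (?s ?z0 ?z1) 1 (?s ?y ?z1)"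
    using exec_go[of 0 MRight "?s ?z0 ?z1"] by simp
  let ?y' = "(ls, Semicolon # Blank # tl (q @ [Blank]))"
  have 4: "exec (Act [(0, \<lambda>r. (Blank, MLeft))]) (?s ?y ?z1) 1 (?s ?y' ?z1)"
    by (rule exec_Act) simp
  let ?a = "enc_bool (One \<notin> set q \<or> \<not> b \<and> e)"
  have 5: "exec (Act [(0, \<lambda>r. (if r 1 = Blank \<or> r 3 = Blank \<and> r 4 = Blank \<and> r 5 = Blank \<and> r 6 = Blank
                   then One else Zero, Stay))]) (?s ?y' ?z1) 1
     (?s (ls, ?a @ Blank # tl (q @ [Blank])) ?z1)"
    by (rule exec_Act) (use eq d(2) in \<open>auto simp: enc_bool_def reg_def\<close>)
  have "exec answer (?s ?z0 ([], Blank # q @ [Blank])) (2 * length q + 20)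
      (?s (ls, ?a @ Blank # tl (q @ [Blank])) ?z1)"
    unfolding answer_def
    by (intro exec_mono[OF exec_Seq[OF 1 exec_Seq[OF 2 exec_Seq[OF 3 exec_Seq[OF 4 5]]]]]) (use t(2) in simp)
  then show ?thesis by blast
qed

text \<open>One program for both oracles: the flags select the partition whose classes are tested.
  All three sections are traversed in either case, since the tallies decide whether the matroid is
  \<open>{{}}\<close>.\<close>

definition oracle_com :: "bool \<Rightarrow> bool \<Rightarrow> com" where
  "oracle_com fst_chk snd_chk = fetch_query ;; While (\<lambda>r. r 0 \<noteq> Semicolon) (go 0 MRight) ;;
     check_section 4 fst_chk ;; check_section 5 snd_chk ;; check_section 6 False ;; compare_counters ;; answer"

lemma wf_oracle_com: "wf_com 7 (oracle_com fst_chk snd_chk)"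
  by (auto simp: oracle_com_def fetch_query_def check_section_def check_class_def check_bits_def
      compare_counters_def counters_left_def answer_def go_def)
    (auto simp: symbols_def)

lemma hits_enc_set: "hits (enc_set n U) (enc_set n X) = card (X \<inter> U \<inter> {..<n})"
proof -
  have "hits (enc_set n U) (enc_set n X) = length (filter (\<lambda>i. i \<in> U \<and> i \<in> X) [0..<n])"
    by (auto simp: hits_def enc_set_def zip_map_map zip_same_conv_map filter_map o_def
        intro!: arg_cong[of _ _ length] filter_cong)
  also have "\<dots> = card (set (filter (\<lambda>i. i \<in> U \<and> i \<in> X) [0..<n]))"
    by (rule distinct_card[symmetric]) simp
  also have "set (filter (\<lambda>i. i \<in> U \<and> i \<in> X) [0..<n]) = X \<inter> U \<inter> {..<n}" by auto
  finally show ?thesis .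
qed

lemma One_in_enc_set: "X \<subseteq> {..<n} \<Longrightarrow> One \<in> set (enc_set n X) \<longleftrightarrow> X \<noteq> {}"
  by (auto simp: enc_set_def split: if_splits)

lemma exec_oracle_com:
  fixes n Us1 Us2 Us3 X
  assumes X: "X \<subseteq> {..<n}"
  defines "u \<equiv> enc_pm_triple (n, Us1, Us2, Us3) @ Semicolon # enc_set n X"
  shows "\<exists>\<sigma>' ls rs. exec (oracle_com fst_chk snd_chk) (st ([Blank], u @ [Blank]) ([], [Blank]) (reg False) (reg False) (\<lambda>_. ([], [])))
      (100 * (length u + 1) ^ 2) \<sigma>' \<and>
    \<sigma>' 0 = (ls, enc_bool (X = {} \<or> (length Us1 = length Us2 \<and> length Us2 = length Us3) \<and>
       (fst_chk \<longrightarrow> (\<forall>U\<in>set Us1. card (X \<inter> U) \<le> 1)) \<and> (snd_chk \<longrightarrow> (\<forall>U\<in>set Us2. card (X \<inter> U) \<le> 1))) @ Blank # rs)"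
proof -
  let ?c = "enc_classes n" and ?q = "enc_set n X" and ?pre = "enc_pm_triple (n, Us1, Us2, Us3)"
  let ?h = "\<lambda>Us. \<exists>U\<in>set Us. hits (enc_set n U) ?q \<ge> 2"
  have sq: "set ?q \<subseteq> {Zero, One}" by (rule set_enc_set)
  then have q: "Blank \<notin> set ?q" "Semicolon \<notin> set ?q" by auto
  have pre: "Blank \<notin> set ?pre"
    using set_enc_classes[of n Us1] set_enc_classes[of n Us2] set_enc_classes[of n Us3]
    by (auto simp: enc_set_full)
  define D where "D = ?q @ [Blank]"
  define C where "C = ?c Us3 @ Semicolon # D"
  define B where "B = ?c Us2 @ Semicolon # C"
  define A where "A = ?c Us1 @ Semicolon # B"
  have u: "u @ [Blank] = replicate n One @ Semicolon # A"
    by (simp add: u_def A_def B_def C_def D_def enc_set_full)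
  have u': "u @ [Blank] = ?pre @ Semicolon # ?q @ [Blank]" by (simp add: u_def)
  let ?z1 = "([], Blank # ?q @ [Blank])" and ?\<rho>0 = "\<lambda>_::nat. ([], []) :: zipper"
  have 1: "exec fetch_query (st ([Blank], u @ [Blank]) ([], [Blank]) (reg False) (reg False) ?\<rho>0)
     (4 * length ?pre + 4 * length ?q + 20) (st ([Blank], u @ [Blank]) ?z1 (reg False) (reg False) ?\<rho>0)"
    unfolding u' using pre q by (intro exec_fetch_query)
  define l0 where "l0 = replicate n One @ [Blank]"
  have 2: "exec (While (\<lambda>r. r 0 \<noteq> Semicolon) (go 0 MRight))
     (st ([Blank], u @ [Blank]) ?z1 (reg False) (reg False) ?\<rho>0) (2 * n + 1)
     (st (l0, Semicolon # A) ?z1 (reg False) (reg False) ?\<rho>0)"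
    unfolding u l0_def
    using exec_scan_right[of "st ([Blank], replicate n One @ Semicolon # A) ?z1 (reg False) (reg False) ?\<rho>0" 0
      "[Blank]" "replicate n One" "Semicolon # A" "\<lambda>s. s \<noteq> Semicolon"] by simp
  define l1 where "l1 = rev (?c Us1) @ Semicolon # l0"
  define \<rho>1 where "\<rho>1 = ?\<rho>0(4 := (replicate (length Us1) One, []))"
  obtain s1 where 3: "exec (check_section 4 fst_chk) (st (l0, Semicolon # A) ?z1 (reg False) (reg False) ?\<rho>0)
     (length Us1 * (4 * n + 9) + 3)
     (st (l1, Semicolon # B) ?z1 (reg s1) (reg (False \<or> fst_chk \<and> ?h Us1)) \<rho>1)"
    using exec_check_section[of 4 ?\<rho>0 ?q n fst_chk l0 Semicolon Us1 B False False] q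
    unfolding A_def l1_def \<rho>1_def by auto
  define l2 where "l2 = rev (?c Us2) @ Semicolon # l1"
  define \<rho>2 where "\<rho>2 = \<rho>1(5 := (replicate (length Us2) One, []))"
  obtain s2 where 4: "exec (check_section 5 snd_chk) (st (l1, Semicolon # B) ?z1 (reg s1) (reg (False \<or> fst_chk \<and> ?h Us1)) \<rho>1)
     (length Us2 * (4 * n + 9) + 3)
     (st (l2, Semicolon # C) ?z1 (reg s2) (reg ((False \<or> fst_chk \<and> ?h Us1) \<or> snd_chk \<and> ?h Us2)) \<rho>2)"
    using exec_check_section[of 5 \<rho>1 ?q n snd_chk l1 Semicolon Us2 C s1 "False \<or> fst_chk \<and> ?h Us1"] q
    unfolding B_def l2_def \<rho>2_def by (auto simp: \<rho>1_def)
  define l3 where "l3 = rev (?c Us3) @ Semicolon # l2"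
  define \<rho>3 where "\<rho>3 = \<rho>2(6 := (replicate (length Us3) One, []))"
  let ?bad = "((False \<or> fst_chk \<and> ?h Us1) \<or> snd_chk \<and> ?h Us2) \<or> False \<and> ?h Us3"
  obtain s3 where 5: "exec (check_section 6 False)
     (st (l2, Semicolon # C) ?z1 (reg s2) (reg ((False \<or> fst_chk \<and> ?h Us1) \<or> snd_chk \<and> ?h Us2)) \<rho>2)
     (length Us3 * (4 * n + 9) + 3)
     (st (l3, Semicolon # D) ?z1 (reg s3) (reg ?bad) \<rho>3)"
    using exec_check_section[of 6 \<rho>2 ?q n False l2 Semicolon Us3 D s2 "(False \<or> fst_chk \<and> ?h Us1) \<or> snd_chk \<and> ?h Us2"] q
    unfolding C_def l3_def \<rho>3_def by (auto simp: \<rho>2_def \<rho>1_def)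
  let ?e = "length Us1 = length Us2 \<and> length Us2 = length Us3"
  have counters: "\<rho>3 4 = (replicate (length Us1) One, [])" "\<rho>3 5 = (replicate (length Us2) One, [])"
    "\<rho>3 6 = (replicate (length Us3) One, [])"
    by (simp_all add: \<rho>3_def \<rho>2_def \<rho>1_def)
  obtain \<rho>4 where 6: "exec compare_counters (st (l3, Semicolon # D) ?z1 (reg s3) (reg ?bad) \<rho>3)
     (2 * length Us1 + 3) (st (l3, Semicolon # D) ?z1 (reg s3) (reg ?bad) \<rho>4)"
    and e: "(reads \<rho>4 4 = Blank \<and> reads \<rho>4 5 = Blank \<and> reads \<rho>4 6 = Blank) \<longleftrightarrow> ?e"
    using exec_compare_counters[OF counters, of "(l3, Semicolon # D)" ?z1 "reg s3" "reg ?bad"]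
    by (elim exE conjE)
  obtain l5 r5 z where 7: "exec answer (st (l3, Semicolon # D) ?z1 (reg s3) (reg ?bad) \<rho>4)
     (2 * length ?q + 20) (st (l5, enc_bool (One \<notin> set ?q \<or> \<not> ?bad \<and> ?e) @ Blank # r5) z (reg s3) (reg ?bad) \<rho>4)"
    using exec_answer[OF sq e, of l3 "reg s3" ?bad] unfolding D_def by blast
  have h: "?h Us \<longleftrightarrow> \<not> (\<forall>U\<in>set Us. card (X \<inter> U) \<le> 1)" for Us
  proof -
    have "X \<inter> U \<inter> {..<n} = X \<inter> U" for U using X by auto
    then show ?thesis by (simp add: hits_enc_set not_le numeral_2_eq_2 Suc_le_eq)
  qed
  have res: "(One \<notin> set ?q \<or> \<not> ?bad \<and> ?e) \<longleftrightarrow> (X = {} \<or> ?e \<and>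
       (fst_chk \<longrightarrow> (\<forall>U\<in>set Us1. card (X \<inter> U) \<le> 1)) \<and> (snd_chk \<longrightarrow> (\<forall>U\<in>set Us2. card (X \<inter> U) \<le> 1)))"
    unfolding h using One_in_enc_set[OF X] by blast
  note run = exec_Seq[OF 1 exec_Seq[OF 2 exec_Seq[OF 3 exec_Seq[OF 4 exec_Seq[OF 5 exec_Seq[OF 6 7]]]]]]
  let ?L = "length u"
  have L: "?L = length ?pre + n + 1" and Lp: "length ?pre = n + length Us1 * (n + 1) + length Us2 * (n + 1) + length Us3 * (n + 1) + 3"
    by (simp_all add: u_def length_enc_classes)
  have nL: "n \<le> ?L" "length ?pre \<le> ?L" "length ?q \<le> ?L" using L by auto
  have Us: "length Us1 \<le> ?L" "length Us2 \<le> ?L" "length Us3 \<le> ?L"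
    using L Lp by (auto simp: algebra_simps)
  have m: "length Us * (4 * n + 9) \<le> ?L * (4 * ?L + 9)" if "length Us \<le> ?L" for Us :: "nat set list"
    using that nL by (intro mult_le_mono) auto
  \<comment> \<open>The left side is \<open>12 * N^2 + 47 * N + 60\<close>; the quadratic part stems
    from comparing every class of the three sections with the query.\<close>
  have poly: "20 * N + 3 * (N * (4 * N + 9)) + 60 \<le> 100 * (N + 1) ^ 2" for N :: nat
    by (simp add: power2_eq_square algebra_simps)
  have sum_bound: "4 * p + 4 * q + 20 + (2 * a + 1 + (t1 + 3 + (t2 + 3 + (t3 + 3 +
      (2 * s + 3 + (2 * q + 20) + 1) + 1) + 1) + 1) + 1) + 1 \<le> R"
    if "a \<le> N" "p \<le> N" "q \<le> N" "s \<le> N" "t1 \<le> T" "t2 \<le> T" "t3 \<le> T" "20 * N + 3 * T + 60 \<le> R"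
    for a p q s t1 t2 t3 N T R :: nat
    using that by linarith
  have "exec (oracle_com fst_chk snd_chk) (st ([Blank], u @ [Blank]) ([], [Blank]) (reg False) (reg False) ?\<rho>0)
      (100 * (?L + 1) ^ 2) (st (l5, enc_bool (One \<notin> set ?q \<or> \<not> ?bad \<and> ?e) @ Blank # r5) z (reg s3) (reg ?bad) \<rho>4)"
    unfolding oracle_com_def
    by (rule exec_mono[OF run]) (rule sum_bound[OF nL Us(1) m[OF Us(1)] m[OF Us(2)] m[OF Us(3)] poly])
  then show ?thesis unfolding res
    by (intro exI conjI) (assumption, simp)
qed

section \<open>Correctness of the reduction\<close>

lemma partition_matroid_subset:
  assumes "X \<in> partition_matroid S \<U>" "Y \<subseteq> X" "finite S"
  shows "Y \<in> partition_matroid S \<U>"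
proof -
  have "finite X" using assms by (auto simp: partition_matroid_def intro: finite_subset)
  then have "card (Y \<inter> U) \<le> card (X \<inter> U)" for U
    using assms(2) by (intro card_mono) auto
  then show ?thesis using assms le_trans unfolding partition_matroid_def by blast
qed

lemma card_eq_sum_parts:
  assumes "partition_on S \<U>" "finite S" "X \<subseteq> S"
  shows "card X = (\<Sum>U\<in>\<U>. card (X \<inter> U))"
proof -
  have fin: "finite \<U>" using assms finite_elements by blast
  have "X = (\<Union>U\<in>\<U>. X \<inter> U)" using assms by (auto simp: partition_on_def)
  then have "card X = card (\<Union>U\<in>\<U>. X \<inter> U)" by simp
  also have "\<dots> = (\<Sum>U\<in>\<U>. card (X \<inter> U))"
    using assms fin
    by (intro card_UN_disjoint) (auto simp: partition_on_def disjoint_def intro: finite_subset)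
  finally show ?thesis .
qed

text \<open>For the exchange property, sum over the classes: some class contains more of
  \<open>Y\<close> than of \<open>X\<close>. As \<open>Y\<close> has at most one element there,
  \<open>X\<close> has none, and that element of \<open>Y\<close> can be added to
  \<open>X\<close>.\<close>

lemma matroid_partition_matroid:
  assumes part: "partition_on S \<U>" and fin: "finite S"
  shows "matroid S (partition_matroid S \<U>)"
  unfolding matroid_def
proof (intro conjI ballI impI allI)
  fix X Y assume X: "X \<in> partition_matroid S \<U>" and Y: "Y \<in> partition_matroid S \<U>" and lt: "card X < card Y"
  have sub: "X \<subseteq> S" "Y \<subseteq> S" using X Y by (auto simp: partition_matroid_def)
  have "\<exists>U\<in>\<U>. card (X \<inter> U) < card (Y \<inter> U)"
  proof (rule ccontr)
    assume "\<not> ?thesis"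
    then have "(\<Sum>U\<in>\<U>. card (Y \<inter> U)) \<le> (\<Sum>U\<in>\<U>. card (X \<inter> U))" by (intro sum_mono) auto
    then show False using lt card_eq_sum_parts[OF part fin] sub by simp
  qed
  then obtain U where U: "U \<in> \<U>" "card (X \<inter> U) < card (Y \<inter> U)" by blast
  then have "card (X \<inter> U) = 0" using Y by (force simp: partition_matroid_def)
  then have empty: "X \<inter> U = {}" using sub fin by (meson card_0_eq finite_Int finite_subset)
  have "Y \<inter> U \<noteq> {}" using U by auto
  then obtain y where y: "y \<in> Y" "y \<in> U" by auto
  have "card (insert y X \<inter> W) \<le> 1" if W: "W \<in> \<U>" for W
  proof (cases "W = U")
    case True
    then show ?thesis using empty y by simp
  next
    case False
    then have "y \<notin> W" using part U(1) W y(2) by (auto simp: partition_on_def disjoint_def)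
    then show ?thesis using X W by (auto simp: partition_matroid_def)
  qed
  then have "insert y X \<in> partition_matroid S \<U>" using sub y by (auto simp: partition_matroid_def)
  moreover have "y \<notin> X" using empty y by auto
  ultimately show "\<exists>y\<in>Y - X. insert y X \<in> partition_matroid S \<U>" using y by blast
next
  fix X Y assume "X \<in> partition_matroid S \<U>" "Y \<subseteq> X"
  then show "Y \<in> partition_matroid S \<U>" using fin by (rule partition_matroid_subset)
qed (use fin in \<open>auto simp: partition_matroid_def\<close>)

lemma card_indep_le:
  assumes "partition_on S \<U>" "finite S" "X \<in> partition_matroid S \<U>"
  shows "card X \<le> card \<U>"
proof -
  have "card X = (\<Sum>U\<in>\<U>. card (X \<inter> U))"
    using assms by (intro card_eq_sum_parts) (auto simp: partition_matroid_def)
  also have "\<dots> \<le> (\<Sum>U\<in>\<U>. 1)"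
    using assms by (intro sum_mono) (auto simp: partition_matroid_def)
  finally show ?thesis by simp
qed

text \<open>A maximal independent set meets every class, since a missed class is nonempty and could
  contribute an element. Conversely, a transversal has \<open>card \<U>\<close> elements, and no
  independent set has more.\<close>

lemma bases_partition_matroid:
  assumes part: "partition_on S \<U>" and fin: "finite S"
  shows "bases (partition_matroid S \<U>) = {B. B \<subseteq> S \<and> (\<forall>U\<in>\<U>. card (B \<inter> U) = 1)}"
proof (intro set_eqI iffI)
  fix B assume B: "B \<in> bases (partition_matroid S \<U>)"
  then have ind: "B \<in> partition_matroid S \<U>" by (auto simp: bases_def)
  then have BS: "B \<subseteq> S" by (auto simp: partition_matroid_def)
  have "card (B \<inter> U) = 1" if U: "U \<in> \<U>" for U
  proof (rule ccontr)
    assume "card (B \<inter> U) \<noteq> 1"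
    moreover have "card (B \<inter> U) \<le> 1" using ind U by (auto simp: partition_matroid_def)
    ultimately have "card (B \<inter> U) = 0" by simp
    then have empty: "B \<inter> U = {}" using BS fin by (meson card_0_eq finite_Int finite_subset)
    obtain u where u: "u \<in> U" using part U by (metis ex_in_conv partition_on_def)
    have "card (insert u B \<inter> W) \<le> 1" if W: "W \<in> \<U>" for W
    proof (cases "W = U")
      case True
      then show ?thesis using empty u by simp
    next
      case False
      then have "u \<notin> W" using part U W u by (auto simp: partition_on_def disjoint_def)
      then show ?thesis using ind W by (auto simp: partition_matroid_def)
    qed
    moreover have "u \<in> S" using part U u by (auto simp: partition_on_def)
    ultimately have "insert u B \<in> partition_matroid S \<U>" using BS by (auto simp: partition_matroid_def)
    then have "insert u B = B" using B by (auto simp: bases_def)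
    then show False using empty u by auto
  qed
  then show "B \<in> {B. B \<subseteq> S \<and> (\<forall>U\<in>\<U>. card (B \<inter> U) = 1)}" using BS by simp
next
  fix B assume B: "B \<in> {B. B \<subseteq> S \<and> (\<forall>U\<in>\<U>. card (B \<inter> U) = 1)}"
  then have ind: "B \<in> partition_matroid S \<U>" by (auto simp: partition_matroid_def)
  have "card B = card \<U>" using card_eq_sum_parts[OF part fin] B by simp
  then have "X = B" if X: "X \<in> partition_matroid S \<U>" "B \<subseteq> X" for X
  proof -
    have "finite X" using X(1) fin by (auto simp: partition_matroid_def intro: finite_subset)
    then show ?thesis
      using card_seteq[of X B] X(2) card_indep_le[OF part fin X(1)] \<open>card B = card \<U>\<close> by simp
  qed
  then show "B \<in> bases (partition_matroid S \<U>)" using ind by (auto simp: bases_def)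
qed

lemma card_basis:
  assumes "partition_on S \<U>" "finite S" "B \<in> bases (partition_matroid S \<U>)"
  shows "card B = card \<U>"
  using assms card_eq_sum_parts[OF assms(1,2)] by (simp add: bases_partition_matroid)

text \<open>Classes are nonempty, so one element can be chosen in each; disjointness keeps the
  choices for other classes out.\<close>

lemma transversal_exists:
  assumes "partition_on S \<U>"
  obtains B where "B \<subseteq> S" "\<forall>U\<in>\<U>. card (B \<inter> U) = 1"
proof -
  have ne: "\<forall>U\<in>\<U>. \<exists>u. u \<in> U" using assms by (metis ex_in_conv partition_on_def)
  then obtain f where f: "\<forall>U\<in>\<U>. f U \<in> U" by metis
  have "f ` \<U> \<inter> U = {f U}" if "U \<in> \<U>" for U
  proof -
    have "W = U" if "W \<in> \<U>" "f W \<in> U" for W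
      using assms f that \<open>U \<in> \<U>\<close> by (auto simp: partition_on_def disjoint_def)
    then show ?thesis using f that by auto
  qed
  then have "\<forall>U\<in>\<U>. card (f ` \<U> \<inter> U) = 1" by simp
  moreover have "f ` \<U> \<subseteq> S" using f assms by (auto simp: partition_on_def)
  ultimately show thesis by (rule that[rotated])
qed

lemma rank_partition_matroid:
  assumes part: "partition_on S \<U>" and fin: "finite S"
  shows "matroid_rank (partition_matroid S \<U>) = card \<U>"
proof -
  obtain B where B: "B \<subseteq> S" "\<forall>U\<in>\<U>. card (B \<inter> U) = 1" by (rule transversal_exists[OF part])
  have "card B = card \<U>" using card_eq_sum_parts[OF part fin B(1)] B(2) by simp
  moreover have "B \<in> partition_matroid S \<U>" using B by (auto simp: partition_matroid_def)
  moreover have "finite (partition_matroid S \<U>)"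
    using fin by (auto simp: partition_matroid_def intro: finite_subset[of _ "Pow S"])
  ultimately show ?thesis unfolding matroid_rank_def
    using card_indep_le[OF part fin] by (intro Max_eqI) (auto intro: rev_image_eqI)
qed

section \<open>The matroids of the target instance and their oracles\<close>

lemma matroid_trivial: "finite S \<Longrightarrow> matroid S {{}}" "matroid_rank {{}} = 0"
  by (auto simp: matroid_def matroid_rank_def)

fun equal_ranks :: "pm_triple \<Rightarrow> bool" where
  "equal_ranks (n, Us1, Us2, Us3) \<longleftrightarrow> length Us1 = length Us2 \<and> length Us2 = length Us3"

text \<open>If the ranks differ there is no common basis. The matroids then have rank \<open>0\<close>, so that a
  feasible partition would have no parts, although the ground set is not empty.\<close>

fun first_matroid :: "pm_triple \<Rightarrow> nat set set" where
  "first_matroid (n, Us1, Us2, Us3) =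
     (if equal_ranks (n, Us1, Us2, Us3) then partition_matroid {..<n} (set Us1) else {{}})"

fun second_matroid :: "pm_triple \<Rightarrow> nat set set" where
  "second_matroid (n, Us1, Us2, Us3) =
     (if equal_ranks (n, Us1, Us2, Us3) then partition_matroid {..<n} (set Us2) else {{}})"

text \<open>The hypothesis is the answer of \<open>oracle_com\<close> in the form of a membership
  condition. The flags specialise it to either matroid, and the disjunct \<open>X = {}\<close>
  accounts for the degenerate matroid \<open>{{}}\<close>.\<close>

lemma polytime_oracle_star_graph:
  assumes I: "\<And>n Us1 Us2 Us3 X. X \<subseteq> {..<n} \<Longrightarrow> X \<in> I (n, Us1, Us2, Us3) \<longleftrightarrow>
     X = {} \<or> (length Us1 = length Us2 \<and> length Us2 = length Us3) \<and>
       (fst_chk \<longrightarrow> (\<forall>U\<in>set Us1. card (X \<inter> U) \<le> 1)) \<and> (snd_chk \<longrightarrow> (\<forall>U\<in>set Us2. card (X \<inter> U) \<le> 1))"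
  shows "polytime_oracle D enc_pm_triple star_graph I"
  unfolding polytime_oracle_def
proof (rule polytime_computable_exec[OF wf_oracle_com[of fst_chk snd_chk], where c = 100 and d = 2])
  fix y assume y: "y \<in> {(x, X). x \<in> D \<and> X \<subseteq> wg_verts (star_graph x)}"
  obtain n Us1 Us2 Us3 X where y_eq: "y = ((n, Us1, Us2, Us3), X)" by (cases y) auto
  have X: "X \<subseteq> {..<n}" using y by (simp add: y_eq)
  let ?u = "enc_pm_triple (n, Us1, Us2, Us3) @ Semicolon # enc_set n X"
  let ?\<sigma> = "st ([Blank], ?u @ [Blank]) ([], [Blank]) (reg False) (reg False) (\<lambda>_. ([], []))"
  have ini: "initial ?\<sigma> ?u"
    using represents_word_tape[of 1 ?u 1] represents_word_tape[of 0 "[]" 1]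
      represents_word_tape[of 0 "[]" 0]
    by (auto simp: initial_def st_def reg_def)
  obtain \<sigma>' ls rs where run: "exec (oracle_com fst_chk snd_chk) ?\<sigma> (100 * (length ?u + 1) ^ 2) \<sigma>'"
    "\<sigma>' 0 = (ls, enc_bool (X \<in> I (n, Us1, Us2, Us3)) @ Blank # rs)"
    using exec_oracle_com[OF X, where fst_chk = fst_chk and snd_chk = snd_chk
        and ?Us1.0 = Us1 and ?Us2.0 = Us2 and ?Us3.0 = Us3]
    unfolding I[OF X] by (elim exE conjE)
  let ?enc = "\<lambda>(x, X). enc_pm_triple x @ Semicolon # enc_set (card (wg_verts (star_graph x))) X"
  show "\<exists>\<sigma> \<sigma>' ls rs. initial \<sigma> (?enc y) \<and>
        exec (oracle_com fst_chk snd_chk) \<sigma> (100 * (length (?enc y) + 1) ^ 2) \<sigma>' \<and>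
        \<sigma>' 0 = (ls, enc_bool (case y of (x, X) \<Rightarrow> X \<in> I x) @ Blank # rs)"
    unfolding y_eq prod.case star_graph.simps wg_verts.simps card_lessThan
    by (intro exI conjI) (rule ini run)+
qed (auto simp: enc_bool_def)

lemma polytime_first_matroid: "polytime_oracle D enc_pm_triple star_graph first_matroid"
  by (rule polytime_oracle_star_graph[where fst_chk = True and snd_chk = False])
    (auto simp: partition_matroid_def)

lemma polytime_second_matroid: "polytime_oracle D enc_pm_triple star_graph second_matroid"
  by (rule polytime_oracle_star_graph[where fst_chk = False and snd_chk = True])
    (auto simp: partition_matroid_def)

section \<open>The star graph and its zero cuts\<close>

lemma set_star:
  assumes "finite U"
  shows "set (star U) = (\<lambda>j. ({Min U, j}, 1)) ` (U - {Min U})"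
  using assms by (simp add: star_def)

lemma distinct_star: "distinct (map fst (star U))"
  by (auto simp: star_def o_def distinct_map inj_on_def doubleton_eq_iff)

text \<open>Edges of one star differ in the endpoint other than the centre. Edges of different stars
  lie in disjoint classes: a shared edge would put the centre of one class into the other.\<close>

lemma wf_star_graph:
  assumes "pm_triple_instance x"
  shows "wf_wgraph (star_graph x)"
proof -
  obtain n Us1 Us2 Us3 where x: "x = (n, Us1, Us2, Us3)" by (cases x)
  have d: "distinct Us3" "partition_on {..<n} (set Us3)" using assms by (auto simp: x)
  have fin: "finite U" "U \<noteq> {}" if "U \<in> set Us3" for U
    using d(2) that by (auto simp: partition_on_def intro: finite_subset[of _ "{..<n}"])
  have "distinct (map fst (concat (map star Us)))" if "distinct Us" "set Us \<subseteq> set Us3" for Us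
    using that
  proof (induction Us)
    case (Cons U Us)
    have "False" if a: "V \<in> set Us" "e \<in> fst ` set (star U)" "e \<in> fst ` set (star V)" for V e
    proof -
      have UV: "U \<in> set Us3" "V \<in> set Us3" "U \<noteq> V" using Cons.prems a(1) by auto
      then have disj: "U \<inter> V = {}" using d(2) by (auto simp: partition_on_def disjoint_def)
      obtain i where "e = {Min U, i}" "i \<in> U"
        using a(2) unfolding set_star[OF fin(1)[OF UV(1)]] image_image fst_conv by blast
      moreover obtain j where "e = {Min V, j}"
        using a(3) unfolding set_star[OF fin(1)[OF UV(2)]] image_image fst_conv by blast
      moreover have "Min U \<in> U" "Min V \<in> V" using UV fin by (auto intro: Min_in)
      ultimately have "Min V \<in> U \<inter> V" by (metis IntI insertCI insertE singletonD)
      then show False using disj by simp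
    qed
    then have "fst ` set (star U) \<inter> fst ` set (concat (map star Us)) = {}"
      unfolding set_concat set_map image_Union image_image by blast
    then show ?case using Cons distinct_star[of U] by simp
  qed simp
  then show ?thesis using d(1) by (simp add: x)
qed

lemma map_of_all_1:
  assumes "\<forall>(e, r)\<in>set es. r = (1::rat)" "e \<in> fst ` set es"
  shows "map_of es e = Some 1"
proof -
  obtain r where r: "map_of es e = Some r" using assms(2) by (metis map_of_eq_None_iff not_Some_eq)
  then show ?thesis using assms(1) map_of_SomeD[OF r] by auto
qed

text \<open>The rank \<open>k\<close> depends on the input: 0 if the numbers of classes differ, and
  their common value otherwise.\<close>

theorem star_graph_correct:
  assumes inst: "pm_triple_instance x"
  shows "\<exists>k. cmmc_instance (wg_verts (star_graph x)) (wg_edges (star_graph x)) (wg_weight (star_graph x))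
       (first_matroid x) (second_matroid x) k \<and>
     (has_common_basis x \<longleftrightarrow>
        cmmc_opt (wg_verts (star_graph x)) (wg_edges (star_graph x)) (wg_weight (star_graph x))
          (first_matroid x) (second_matroid x) k = 0)"
proof -
  obtain n Us1 Us2 Us3 where x: "x = (n, Us1, Us2, Us3)" by (cases x)
  let ?V = "{..<n}"
  define E where "E = wg_edges (star_graph x)"
  define w where "w = wg_weight (star_graph x)"
  have V: "wg_verts (star_graph x) = ?V" by (simp add: x)
  have d: "distinct Us1" "distinct Us2" "distinct Us3"
    and part: "partition_on ?V (set Us1)" "partition_on ?V (set Us2)" "partition_on ?V (set Us3)"
    using inst by (auto simp: x)
  have E: "E = {{Min U, j} |U j. U \<in> set Us3 \<and> j \<in> U - {Min U}}"
  proof -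
    have "finite U" if "U \<in> set Us3" for U
      using part(3) that by (auto simp: partition_on_def intro: finite_subset[of _ ?V])
    then show ?thesis by (force simp: E_def x set_star image_iff)
  qed
  have w: "w e = 1" if "e \<in> E" for e
  proof -
    have "map_of (concat (map star Us3)) e = Some 1"
      by (rule map_of_all_1) (use that in \<open>auto simp: E_def x star_def simp del: set_sorted_list_of_set\<close>)
    then show ?thesis by (simp add: w_def x)
  qed
  have Min: "Min U \<in> U" if "U \<in> set Us3" for U
    using part(3) that by (auto simp: partition_on_def intro!: Min_in intro: finite_subset[of _ ?V])
  have edge: "e \<subseteq> ?V \<and> card e = 2" if "e \<in> E" for e
  proof -
    obtain U j where U: "e = {Min U, j}" "U \<in> set Us3" "j \<in> U" "j \<noteq> Min U"
      using \<open>e \<in> E\<close> by (auto simp: E)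
    then show ?thesis using Min[OF U(2)] part(3) by (auto simp: partition_on_def)
  qed
  have finE: "finite E" using edge by (auto intro: finite_subset[of _ "Pow ?V"])
  have cut_nonneg: "cut_weight E w X \<ge> 0" for X
    unfolding cut_weight_def using w by (intro sum_nonneg) auto
  have common_card: "card B = card (set Us)" if "B \<in> bases (partition_matroid ?V (set Us))"
    "Us \<in> {Us1, Us2, Us3}" for B Us
    using that part by (auto intro!: card_basis)
  show ?thesis
  proof (cases "equal_ranks x")
    case False
    have M: "first_matroid x = {{}}" "second_matroid x = {{}}" using False by (auto simp: x)
    have "\<not> has_common_basis x"
    proof
      assume "has_common_basis x"
      then obtain B where "\<forall>Us\<in>{Us1, Us2, Us3}. B \<in> bases (partition_matroid ?V (set Us))"
        by (auto simp: x)
      then have "card B = card (set Us1)" "card B = card (set Us2)" "card B = card (set Us3)"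
        using common_card by blast+
      then have "length Us1 = length Us2" "length Us2 = length Us3"
        using d by (simp_all add: distinct_card)
      then show False using False by (simp add: x)
    qed
    moreover have "\<not> cmmc_feasible ?V {{}} {{}} 0 P" for P
    proof
      assume f: "cmmc_feasible ?V {{}} {{}} 0 P"
      then have P: "partition_on ?V P" "card P = 0" by (auto simp: cmmc_feasible_def)
      then have "finite P" by (meson finite_elements finite_lessThan)
      then have "P = {}" using P by simp
      \<comment> \<open>The empty set has only the empty partition, so all three lists would be
        empty and the numbers of classes equal after all.\<close>
      then have "?V = {}" using P(1) by (auto simp: partition_on_def)
      then have "set Us1 = {}" "set Us2 = {}" "set Us3 = {}"
        using part by (simp_all only: partition_on_empty)
      then show False using False by (simp add: x)
    qed
    then have "cmmc_opt ?V E w {{}} {{}} 0 = \<infinity>"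
      by (simp add: cmmc_opt_def top_ereal_def)
    moreover have "cmmc_instance ?V E w {{}} {{}} 0"
      using edge w matroid_trivial by (auto simp: cmmc_instance_def)
    ultimately show ?thesis unfolding M V E_def[symmetric] w_def[symmetric]
      by (intro exI[of _ 0]) simp
  next
    case True
    define k where "k = length Us3"
    have k: "card (set Us1) = k" "card (set Us2) = k" "card (set Us3) = k"
      using True d by (auto simp: k_def x distinct_card)
    have M: "first_matroid x = partition_matroid ?V (set Us1)"
      "second_matroid x = partition_matroid ?V (set Us2)" using True by (auto simp: x)
    let ?I1 = "partition_matroid ?V (set Us1)" and ?I2 = "partition_matroid ?V (set Us2)"
    have ci: "cmmc_instance ?V E w ?I1 ?I2 k"
      using edge w part k
      by (auto simp: cmmc_instance_def matroid_partition_matroid rank_partition_matroid)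
    let ?F = "{P. cmmc_feasible ?V ?I1 ?I2 k P}"
    let ?val = "\<lambda>P. \<Sum>X\<in>P. cut_weight E w X"
    have finP: "finite P" if "P \<in> ?F" for P
      using that by (auto simp: cmmc_feasible_def intro: finite_elements[of ?V])
    have finF: "finite ?F"
      by (rule finite_subset[of _ "Pow (Pow ?V)"]) (auto simp: cmmc_feasible_def partition_on_def)
    have nonneg: "?val P \<ge> 0" for P using cut_nonneg by (intro sum_nonneg) auto
    have "has_common_basis x \<longleftrightarrow> cmmc_opt ?V E w ?I1 ?I2 k = 0"
    proof
      assume "has_common_basis x"
      then obtain B where B: "B \<in> bases ?I1" "B \<in> bases ?I2" "B \<in> bases (partition_matroid ?V (set Us3))"
        by (auto simp: x)
      \<comment> \<open>The common basis itself witnesses feasibility: being a basis of the third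
        matroid, it meets every class exactly once.\<close>
      then have F: "set Us3 \<in> ?F" using part k
        by (auto simp: cmmc_feasible_def bases_partition_matroid intro!: bexI[of _ B])
      \<comment> \<open>An edge lies inside one class, so it meets a class in 2 elements or in
        none.\<close>
      have "card (e \<inter> X) \<noteq> 1" if X: "X \<in> set Us3" and e: "e \<in> E" for X e
      proof -
        obtain U j where U: "e = {Min U, j}" "U \<in> set Us3" "j \<in> U" "j \<noteq> Min U"
          using e by (auto simp: E)
        then have eU: "e \<subseteq> U" using Min by auto
        show ?thesis
        proof (cases "X = U")
          case True
          then show ?thesis using eU edge[OF e] by (simp add: Int_absorb2)
        next
          case False
          then have "X \<inter> U = {}" using part(3) X U(2) by (auto simp: partition_on_def disjoint_def)
          then have "e \<inter> X = {}" using eU by auto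
          then show ?thesis by simp
        qed
      qed
      then have "cut_weight E w X = 0" if "X \<in> set Us3" for X
        using that unfolding cut_weight_def by (intro sum.neutral) auto
      then have "?val (set Us3) = 0" by simp
      then have "cmmc_opt ?V E w ?I1 ?I2 k \<le> 0"
        unfolding cmmc_opt_def using F by (intro INF_lower2[of "set Us3"]) auto
      moreover have "cmmc_opt ?V E w ?I1 ?I2 k \<ge> 0"
        unfolding cmmc_opt_def using nonneg by (intro INF_greatest) simp
      ultimately show "cmmc_opt ?V E w ?I1 ?I2 k = 0" by simp
    next
      assume opt: "cmmc_opt ?V E w ?I1 ?I2 k = 0"
      \<comment> \<open>Without feasible partitions the infimum would be that of the empty set,
        which is \<infinity>.\<close>
      have "?F \<noteq> {}"
      proof
        assume "?F = {}"
        then have "cmmc_opt ?V E w ?I1 ?I2 k = \<infinity>"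
          unfolding cmmc_opt_def by (simp only:) (simp add: top_ereal_def)
        then show False using opt by simp
      qed
      \<comment> \<open>A nonempty finite family attains its infimum, so some feasible partition has
        value exactly 0.\<close>
      then have "Inf ((\<lambda>P. ereal (?val P)) ` ?F) \<in> (\<lambda>P. ereal (?val P)) ` ?F"
        using finF by (metis (no_types, lifting) Min_Inf Min_in finite_imageI image_is_empty)
      then obtain P where P: "P \<in> ?F" "ereal (?val P) = 0"
        using opt unfolding cmmc_opt_def by auto
      then have zero: "cut_weight E w X = 0" if "X \<in> P" for X
        using that cut_nonneg finP[OF P(1)] by (simp add: sum_nonneg_eq_0_iff)
      have nocut: "card (e \<inter> X) \<noteq> 1" if "X \<in> P" "e \<in> E" for X e
      proof
        assume "card (e \<inter> X) = 1"
        then have "w e = 0"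
          using zero[OF that(1)] that(2) finE w unfolding cut_weight_def
          by (subst (asm) sum_nonneg_eq_0_iff) auto
        then show False using w that by simp
      qed
      from P(1) obtain B where B: "B \<in> bases ?I1" "B \<in> bases ?I2" "\<forall>X\<in>P. card (B \<inter> X) = 1"
        and PV: "partition_on ?V P" by (auto simp: cmmc_feasible_def)
      have BV: "B \<subseteq> ?V" using B(1) part(1) by (auto simp: bases_partition_matroid)
      have le: "card (B \<inter> U) \<le> 1" if U: "U \<in> set Us3" for U
      proof -
        have "Min U \<in> ?V" using Min[OF U] part(3) U by (auto simp: partition_on_def)
        \<comment> \<open>The part that contains the centre of the star has to contain the whole
          class, because every other element is joined to the centre by an edge that is not
          cut.\<close>
        then obtain X where X: "X \<in> P" "Min U \<in> X" using PV by (auto simp: partition_on_def)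
        have "j \<in> X" if "j \<in> U" for j
        proof (rule ccontr)
          assume j: "j \<notin> X"
          then have "{Min U, j} \<inter> X = {Min U}" using X by auto
          moreover have "{Min U, j} \<in> E" using j X(2) U that by (auto simp: E)
          ultimately show False using nocut[OF X(1), of "{Min U, j}"] by simp
        qed
        then have "B \<inter> U \<subseteq> B \<inter> X" by auto
        then have "card (B \<inter> U) \<le> card (B \<inter> X)"
          using BV by (intro card_mono) (auto intro: finite_subset)
        then show ?thesis using B(3) X(1) by simp
      qed
      have "card B = card (set Us3)" using card_basis[OF part(1) _ B(1)] k by simp
      then have "(\<Sum>U\<in>set Us3. card (B \<inter> U)) = (\<Sum>U\<in>set Us3. 1)"
        using card_eq_sum_parts[OF part(3) _ BV] by simp
      \<comment> \<open>The average over the classes is 1 and no term exceeds 1. The bound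
        \<open>le\<close> makes the truncated subtraction exact, so the deficits sum to 0 and each
        of them vanishes.\<close>
      then have "(\<Sum>U\<in>set Us3. 1 - card (B \<inter> U)) = 0"
        using le by (subst sum_subtractf_nat) auto
      then have "card (B \<inter> U) = 1" if "U \<in> set Us3" for U
        using that le[OF that] by (fastforce simp: sum_eq_0_iff)
      then have "B \<in> bases (partition_matroid ?V (set Us3))"
        using BV part(3) by (simp add: bases_partition_matroid)
      then show "has_common_basis x" using B by (auto simp: x)
    qed
    then show ?thesis unfolding M V E_def[symmetric] w_def[symmetric] using ci by blast
  qed
qed

theorem theorem11:
  "\<exists>(G :: pm_triple \<Rightarrow> wgraph) (\<I>1 :: pm_triple \<Rightarrow> nat set set) (\<I>2 :: pm_triple \<Rightarrow> nat set set).
     polytime_computable (Collect pm_triple_instance) enc_pm_triple enc_wgraph G \<and>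
     polytime_oracle (Collect pm_triple_instance) enc_pm_triple G \<I>1 \<and>
     polytime_oracle (Collect pm_triple_instance) enc_pm_triple G \<I>2 \<and>
     (\<forall>x. pm_triple_instance x \<longrightarrow>
        wf_wgraph (G x) \<and>
        (\<exists>k. cmmc_instance (wg_verts (G x)) (wg_edges (G x)) (wg_weight (G x)) (\<I>1 x) (\<I>2 x) k \<and>
             (has_common_basis x \<longleftrightarrow>
              cmmc_opt (wg_verts (G x)) (wg_edges (G x)) (wg_weight (G x)) (\<I>1 x) (\<I>2 x) k = 0)))"
  using polytime_star_graph polytime_first_matroid polytime_second_matroid wf_star_graph star_graph_correct
  by (intro exI[of _ star_graph] exI[of _ first_matroid] exI[of _ second_matroid] conjI allI impI)

end
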